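(* Let $\widehat g_n$ be the MLE of $g^0$ (defined in the context), where the plug-in estimators $\check\pi_n,\check u_{1,n},\check u_{2,n}$ are consistent for $\pi^0,u^0_1,u^0_2$, respectively. Then $$H(\widehat g_n,g^0)=o_p(1)\quad\text{as } n\to\infty .$$
   Context: $\mathcal{SC}$ is the class of concave functions $\psi:\mathbb R\to[-\infty,\infty)$ that are upper semicontinuous, proper (not identically $-\infty$), and satisfy $\psi(x)=\psi(-x)$ for all $x$; $\mathcal{SLC}=\{e^\psi:\psi\in\mathcal{SC}\}$; $\mathcal{SLC}_1=\{f\in\mathcal{SLC}:\int_{\mathbb R}f=1\}$. $X_1,\dots,X_n$ are i.i.d. with density $g^0(x)=\pi^0 f^0(x-u^0_1)+(1-\pi^0)f^0(x-u^0_2)$, where $f^0\in\mathcal{SLC}_1$, $\pi^0\in(0,1)\setminus\{1/2\}$, $u^0_1,u^0_2\in\mathbb R$, $u^0_1\neq u^0_2$. $\check\pi_n,\check u_{1,n},\check u_{2,n}$ are estimators (functions of $X_1,\dots,X_n$) of $\pi^0,u_1^0,u_2^0$ with $\check\pi_n\in(0,1)\setminus\{1/2\}$ and $\check u_{1,n}<\check u_{2,n}$; consistent means convergent in probability. The MLE: $\widehat f_n=e^{\widehat\psi_n}$, where $\widehat\psi_n$ maximizes over $\mathcal{SC}$ the criterion $$\Phi_n(\psi)=\frac1n\sum_{i=1}^n\log\big[\check\pi_n e^{\psi(X_i-\check u_{1,n})}+(1-\check\pi_n)e^{\psi(X_i-\check u_{2,n})}\big]-\int_{\mathbb R}e^{\psi(x)}dx$$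 (equivalently, $\widehat f_n$ maximizes $f\mapsto\sum_{i}\log(\check\pi_n f(X_i-\check u_{1,n})+(1-\check\pi_n)f(X_i-\check u_{2,n}))$ over $\mathcal{SLC}_1$), and $\widehat g_n=\check\pi_n\widehat f_n(\cdot-\check u_{1,n})+(1-\check\pi_n)\widehat f_n(\cdot-\check u_{2,n})$. Hellinger distance: $H(p,q)=\sqrt{\tfrac12\int(\sqrt{p(x)}-\sqrt{q(x)})^2dx}$. $o_p(1)$ means convergence to $0$ in probability. *)

theory Defs
  imports "HOL-Probability.Probability"
begin

subsection \<open>Symmetric log-concave functions\<close>

text \<open>The conventions \<open>e\<^sup>-\<^sup>\<infinity> = 0\<close> and \<open>log 0 = -\<infinity>\<close>;
  the argument \<open>\<infinity>\<close>, respectively a negative argument, never occurs.\<close>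

definition exp_ereal :: "ereal \<Rightarrow> real" where
  "exp_ereal a = (if a = -\<infinity> then 0 else exp (real_of_ereal a))"

definition ln_ereal :: "real \<Rightarrow> ereal" where
  "ln_ereal r = (if r \<le> 0 then -\<infinity> else ereal (ln r))"

definition concave_ereal :: "(real \<Rightarrow> ereal) \<Rightarrow> bool" where
  "concave_ereal \<psi> \<longleftrightarrow>
     (\<forall>x y. \<forall>t\<in>{0<..<1}. ereal (1 - t) * \<psi> x + ereal t * \<psi> y \<le> \<psi> ((1 - t) * x + t * y))"

definition usc_ereal :: "(real \<Rightarrow> ereal) \<Rightarrow> bool" where
  "usc_ereal \<psi> \<longleftrightarrow> (\<forall>x. Limsup (at x) \<psi> \<le> \<psi> x)"

definition SC :: "(real \<Rightarrow> ereal) set" where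
  "SC = {\<psi>. (\<forall>x. \<psi> x \<noteq> \<infinity>) \<and> concave_ereal \<psi> \<and> usc_ereal \<psi> \<and>
            (\<exists>x. \<psi> x \<noteq> -\<infinity>) \<and> (\<forall>x. \<psi> (- x) = \<psi> x)}"

definition SLC :: "(real \<Rightarrow> real) set" where
  "SLC = {f. \<exists>\<psi>\<in>SC. f = (\<lambda>x. exp_ereal (\<psi> x))}"

text \<open>The Bochner integral of a non-integrable function is 0, so integral 1 entails integrability.\<close>

definition SLC1 :: "(real \<Rightarrow> real) set" where
  "SLC1 = {f \<in> SLC. (\<integral>x. f x \<partial>lborel) = 1}"


subsection \<open>Mixtures, the likelihood criterion, and the Hellinger distance\<close>

definition mix :: "real \<Rightarrow> real \<Rightarrow> real \<Rightarrow> (real \<Rightarrow> real) \<Rightarrow> real \<Rightarrow> real" where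
  "mix \<pi> u1 u2 f x = \<pi> * f (x - u1) + (1 - \<pi>) * f (x - u2)"

text \<open>The observations \<open>X\<^sub>1, \<dots>, X\<^sub>n\<close> are indexed by \<open>0, \<dots>, n - 1\<close>. The criterion takes the value
  \<open>-\<infinity>\<close> if some observation has mixture density 0 or if \<open>e\<^sup>\<psi>\<close> has infinite integral; it never
  takes the value \<open>\<infinity>\<close> for \<open>n \<ge> 1\<close>, so \<open>\<infinity> - \<infinity>\<close> does not arise.\<close>

definition Phi :: "nat \<Rightarrow> (nat \<Rightarrow> real) \<Rightarrow> real \<Rightarrow> real \<Rightarrow> real \<Rightarrow> (real \<Rightarrow> ereal) \<Rightarrow> ereal" where
  "Phi n x \<pi> u1 u2 \<psi> =
     ereal (1 / real n) * (\<Sum>i<n. ln_ereal (mix \<pi> u1 u2 (\<lambda>z. exp_ereal (\<psi> z)) (x i)))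
     - enn2ereal (\<integral>\<^sup>+z. ennreal (exp_ereal (\<psi> z)) \<partial>lborel)"

definition is_MLE :: "nat \<Rightarrow> (nat \<Rightarrow> real) \<Rightarrow> real \<Rightarrow> real \<Rightarrow> real \<Rightarrow> (real \<Rightarrow> ereal) \<Rightarrow> bool" where
  "is_MLE n x \<pi> u1 u2 \<psi> \<longleftrightarrow>
     \<psi> \<in> SC \<and> (\<forall>\<phi>\<in>SC. Phi n x \<pi> u1 u2 \<phi> \<le> Phi n x \<pi> u1 u2 \<psi>)"

text \<open>Intended for nonnegative integrable \<open>p\<close>, \<open>q\<close>, for which the integrand is integrable.\<close>

definition hellinger :: "(real \<Rightarrow> real) \<Rightarrow> (real \<Rightarrow> real) \<Rightarrow> real" where
  "hellinger p q = sqrt (1 / 2 * (\<integral>x. (sqrt (p x) - sqrt (q x))\<^sup>2 \<partial>lborel))"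


subsection \<open>Samples and convergence in probability\<close>

definition data_space :: "nat \<Rightarrow> (nat \<Rightarrow> real) measure" where
  "data_space n = (\<Pi>\<^sub>M i\<in>{..<n}. borel)"

definition sample :: "(nat \<Rightarrow> 'w \<Rightarrow> real) \<Rightarrow> nat \<Rightarrow> 'w \<Rightarrow> nat \<Rightarrow> real" where
  "sample X n w = (\<lambda>i\<in>{..<n}. X i w)"

text \<open>The outer measure makes this meaningful without measurability of \<open>Z n\<close>: \<open>measure\<close> and
  \<open>emeasure\<close> are 0 on non-measurable sets, and a maximum likelihood estimator is an arbitrary,
  possibly non-measurable, choice of a maximizer. For measurable \<open>Z n\<close> it is the usual notion.\<close>

definition tendsto_in_prob :: "'w measure \<Rightarrow> (nat \<Rightarrow> 'w \<Rightarrow> real) \<Rightarrow> real \<Rightarrow> bool" where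
  "tendsto_in_prob M Z c \<longleftrightarrow>
     (\<forall>\<epsilon>>0. (\<lambda>n. outer_measure_of M {w \<in> space M. \<bar>Z n w - c\<bar> > \<epsilon>}) \<longlonglongrightarrow> 0)"

lemma tendsto_in_prob_measurable:
  assumes "prob_space M" and "\<And>n. Z n \<in> borel_measurable M"
  shows "tendsto_in_prob M Z c \<longleftrightarrow>
    (\<forall>\<epsilon>>0. (\<lambda>n. measure M {w \<in> space M. \<bar>Z n w - c\<bar> > \<epsilon>}) \<longlonglongrightarrow> 0)"
proof -
  interpret prob_space M by fact
  have [measurable]: "Z n \<in> borel_measurable M" for n by (rule assms(2))
  have "outer_measure_of M {w \<in> space M. \<bar>Z n w - c\<bar> > \<epsilon>}
      = ennreal (measure M {w \<in> space M. \<bar>Z n w - c\<bar> > \<epsilon>})" for n \<epsilon>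
    by (subst outer_measure_of_eq) (auto simp: emeasure_eq_measure)
  then show ?thesis
    unfolding tendsto_in_prob_def by (simp flip: ennreal_0)
qed

end

theory Submission
  imports Defs
begin

text \<open>Write \<open>P\<^sub>n\<close> for the empirical mean over the observations, \<open>p\<close> for the fitted density \<open>ghat\<close> and \<open>f\<close> for its
  component \<open>fhat\<close>. The proof derives the closeness of \<open>p\<close> and \<open>g0\<close> from the likelihood inequality that defines \<open>p\<close>,
  made robust against errors in the estimated parameters, and a uniform law of large numbers for \<open>ln (p + \<eta>)\<close>.

  The fitted density has almost the likelihood of the true one: \<open>P\<^sub>n ln p \<ge> P\<^sub>n ln g0 - o(1)\<close>. The component \<open>f0\<close> itself is a
  bad competitor, since at the estimated locations its support may miss observations. The competitor that inserts a plateau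
  of width \<open>2 d\<close> at the mode of \<open>f0\<close> is again symmetric and log-concave, it dominates all translates of \<open>f0\<close> by at most
  \<open>d\<close>, and its integral exceeds \<open>1\<close> by \<open>2 d f0(0)\<close> only; the criterion does not require competitors to be
  normalized (lemma \<open>MLE_loglik_lower_bound\<close>).

  The peak \<open>f(0)\<close> stays bounded. A symmetric log-concave density with peak \<open>M\<close> is at most \<open>2 M exp (- ln 2 M \<bar>x\<bar>)\<close>
  (lemma \<open>SLC1_exp_decay\<close>), and the observations have a positive average distance from the two locations, so
  \<open>P\<^sub>n ln p \<le> ln (2 M) - c M\<close> with a constant \<open>c > 0\<close>, which for large \<open>M\<close> contradicts the lower bound
  (lemma \<open>loglik_le_of_peak\<close>).

  With bounded peaks, the functions \<open>ln (p + \<eta>)\<close> are uniformly bounded and of uniformly bounded variation, because \<open>p\<close> is a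
  mixture of two unimodal functions. The law of large numbers for the finitely many cells of a fine partition of the line
  therefore gives \<open>P\<^sub>n ln (p + \<eta>) \<le> \<integral> g0 ln (p + \<eta>) + o(1)\<close> uniformly (lemma \<open>loglik_uniform_upper_bound\<close>). Only upper
  bounds on \<open>ln p\<close> matter, so adding \<open>\<eta>\<close>, which can only increase \<open>P\<^sub>n ln p\<close>, is harmless.

  Altogether \<open>\<integral> g0 ln ((p + \<eta>) / g0) \<ge> - o(1)\<close>. By \<open>ln t \<le> 2 (sqrt t - 1)\<close> the affinity \<open>\<integral> sqrt (p g0)\<close> is at least
  \<open>1 - o(1) - sqrt \<eta> \<integral> sqrt g0\<close>, and \<open>sqrt g0\<close> is integrable since \<open>g0\<close> has exponential tails
  (lemma \<open>hellinger_le_of_loglik\<close>). Letting \<open>\<eta>\<close> tend to \<open>0\<close> gives the claim.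

  All this is deterministic: it holds for every sample that has positive density \<open>g0\<close> at each observation and on which
  finitely many empirical means and the estimated parameters are accurate (lemma \<open>hellinger_MLE_le\<close>). Probability
  enters only through the weak law of large numbers, whose proof by Chebyshev's inequality requires second moments,
  hence the integrability of \<open>g0 (ln g0)\<^sup>2\<close>.\<close>

section \<open>Symmetric log-concave functions\<close>

lemma exp_ereal_nonneg [simp]: "0 \<le> exp_ereal a"
  by (simp add: exp_ereal_def)

lemma exp_ereal_mono: "a \<le> b \<Longrightarrow> b \<noteq> \<infinity> \<Longrightarrow> exp_ereal a \<le> exp_ereal b"
  by (cases a; cases b) (auto simp: exp_ereal_def)

lemma exp_ereal_convex_comb:
  assumes "a \<noteq> \<infinity>" "b \<noteq> \<infinity>" "0 < t" "t < 1"
  shows "exp_ereal a powr (1 - t) * exp_ereal b powr t = exp_ereal (ereal (1 - t) * a + ereal t * b)"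
  using assms
  by (cases a; cases b) (auto simp: exp_ereal_def exp_powr_real mult_exp_exp algebra_simps)

lemma SC_concave:
  "\<psi> \<in> SC \<Longrightarrow> 0 < t \<Longrightarrow> t < 1 \<Longrightarrow>
    ereal (1 - t) * \<psi> x + ereal t * \<psi> y \<le> \<psi> ((1 - t) * x + t * y)"
  by (simp add: SC_def concave_ereal_def)

text \<open>A point \<open>x\<close> with \<open>\<bar>x\<bar> < \<bar>y\<bar>\<close> is a convex combination of \<open>-y\<close> and \<open>y\<close>, where \<open>\<psi>\<close> takes the same value;
  so symmetry turns concavity into unimodality about \<open>0\<close>.\<close>
lemma SC_antimono:
  assumes "\<psi> \<in> SC" "\<bar>x\<bar> \<le> \<bar>y\<bar>"
  shows "\<psi> y \<le> \<psi> x"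
proof (cases "\<bar>x\<bar> = \<bar>y\<bar>")
  case True
  then have "x = y \<or> x = - y" by linarith
  then show ?thesis using assms(1) by (auto simp: SC_def)
next
  case False
  then have y: "\<bar>x\<bar> < \<bar>y\<bar>" using assms(2) by simp
  define t where "t = (1 + x / y) / 2"
  have t: "0 < t" "t < 1" "(1 - t) * (- y) + t * y = x"
    using y by (auto simp: t_def field_simps abs_if split: if_splits)
  have "\<psi> (-y) = \<psi> y" "\<psi> y \<noteq> \<infinity>" using assms(1) by (auto simp: SC_def)
  moreover have "ereal (1 - t) * \<psi> (-y) + ereal t * \<psi> y \<le> \<psi> ((1 - t) * (- y) + t * y)"
    by (rule SC_concave[OF assms(1) t(1,2)])
  moreover have "ereal (1 - t) * \<psi> y + ereal t * \<psi> y = \<psi> y"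
    using \<open>\<psi> y \<noteq> \<infinity>\<close> t by (cases "\<psi> y") (auto simp: algebra_simps)
  ultimately show ?thesis using t(3) by metis
qed

lemma SLC_nonneg: "f \<in> SLC \<Longrightarrow> 0 \<le> f x"
  by (auto simp: SLC_def)

lemma SLC_even: "f \<in> SLC \<Longrightarrow> f (- x) = f x"
  by (auto simp: SLC_def SC_def)

lemma SLC_antimono: "f \<in> SLC \<Longrightarrow> \<bar>x\<bar> \<le> \<bar>y\<bar> \<Longrightarrow> f y \<le> f x"
  by (auto simp: SLC_def intro!: exp_ereal_mono SC_antimono) (auto simp: SC_def)

lemma SLC_le_peak: "f \<in> SLC \<Longrightarrow> f x \<le> f 0"
  by (rule SLC_antimono) auto

lemma SLC_abs: "f \<in> SLC \<Longrightarrow> f \<bar>x\<bar> = f x"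
  by (cases "x \<ge> 0") (auto simp: SLC_even)

lemma SLC_peak_pos: 
  assumes "f \<in> SLC" shows "0 < f 0"
proof -
  obtain \<psi> x where p: "\<psi> \<in> SC" "f = (\<lambda>x. exp_ereal (\<psi> x))" "\<psi> x \<noteq> -\<infinity>"
    using assms by (auto simp: SLC_def SC_def)
  then have "0 < f x" by (auto simp: exp_ereal_def)
  with SLC_le_peak[OF assms, of x] show ?thesis by simp
qed

text \<open>Concavity of \<open>\<psi>\<close> in multiplicative form. For \<open>t > 0\<close> both \<open>0 powr t = 0\<close> and \<open>t * -\<infinity> = -\<infinity>\<close> hold, so points
  with \<open>\<psi> = -\<infinity>\<close> are covered.\<close>
lemma SLC_log_concave:
  assumes "f \<in> SLC" "0 < t" "t < 1"
  shows "f x powr (1 - t) * f y powr t \<le> f ((1 - t) * x + t * y)"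
proof -
  obtain \<psi> where p: "\<psi> \<in> SC" "f = (\<lambda>x. exp_ereal (\<psi> x))"
    using assms by (auto simp: SLC_def)
  then have "\<psi> z \<noteq> \<infinity>" for z by (auto simp: SC_def)
  moreover have "ereal (1 - t) * \<psi> x + ereal t * \<psi> y \<le> \<psi> ((1 - t) * x + t * y)"
    by (rule SC_concave[OF p(1) assms(2,3)])
  ultimately show ?thesis using p assms by (auto simp: exp_ereal_convex_comb intro!: exp_ereal_mono)
qed

text \<open>The two terms of the Jordan decomposition of a unimodal function with mode \<open>0\<close> as a difference of
  increasing functions.\<close>
definition rise :: "(real \<Rightarrow> real) \<Rightarrow> real \<Rightarrow> real" where
  "rise f x = f (min x 0)"

definition drop_off :: "(real \<Rightarrow> real) \<Rightarrow> real \<Rightarrow> real" where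
  "drop_off f x = f 0 - f (max x 0)"

lemma rise_minus_drop_off: "rise f x - drop_off f x = f x"
  by (cases "x \<le> 0") (auto simp: rise_def drop_off_def)

lemma mono_rise: "f \<in> SLC \<Longrightarrow> mono (rise f)"
  by (auto simp: rise_def intro!: monoI SLC_antimono[of f])

lemma mono_drop_off: "f \<in> SLC \<Longrightarrow> mono (drop_off f)"
  by (auto simp: drop_off_def intro!: monoI SLC_antimono[of f])

lemma rise_drop_off_bounds:
  assumes "f \<in> SLC"
  shows "rise f x \<in> {0..f 0}" "drop_off f x \<in> {0..f 0}"
  using SLC_le_peak[OF assms] SLC_nonneg[OF assms] by (auto simp: rise_def drop_off_def)

lemma SLC_borel_measurable:
  assumes "f \<in> SLC" shows "f \<in> borel_measurable borel"
proof -
  have "rise f \<in> borel_measurable borel" "drop_off f \<in> borel_measurable borel"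
    using mono_rise[OF assms] mono_drop_off[OF assms] by (auto intro: borel_measurable_mono)
  then have "(\<lambda>x. rise f x - drop_off f x) \<in> borel_measurable borel"
    by measurable
  then show ?thesis by (simp add: rise_minus_drop_off)
qed

lemma SLC1_integrable:
  "f \<in> SLC1 \<Longrightarrow> integrable lborel f"
  using not_integrable_integral_eq[of lborel f] by (auto simp: SLC1_def)

text \<open>The peak height alone controls the tail. Let \<open>M = f 0\<close>. Since \<open>f\<close> integrates to \<open>1\<close> and is at least
  \<open>f (1/M)\<close> on \<open>[-1/M, 1/M]\<close>, one gets \<open>f (1/M) \<le> M/2\<close>: the density halves within the distance \<open>1/M\<close>.
  Log-concavity propagates this to at least a factor of two over every further interval of that length. For
  large \<open>M\<close> this says that a high peak forces a thin tail.\<close>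
lemma SLC1_exp_decay:
  assumes "f \<in> SLC1"
  shows "f x \<le> 2 * f 0 * exp (- ln 2 * f 0 * \<bar>x\<bar>)"
proof -
  have f: "f \<in> SLC" and int: "integrable lborel f" and one: "(\<integral>x. f x \<partial>lborel) = 1"
    using assms SLC1_integrable by (auto simp: SLC1_def)
  define M where "M = f 0"
  have M: "0 < M" using SLC_peak_pos[OF f] by (simp add: M_def)
  show ?thesis
  proof (cases "\<bar>x\<bar> \<le> 1 / M")
    case True
    then have "M * \<bar>x\<bar> \<le> 1" using M by (simp add: field_simps)
    then have "ln 2 * (M * \<bar>x\<bar>) \<le> ln 2 * 1" by (intro mult_left_mono) auto
    then have "exp (- ln 2) \<le> exp (- (ln 2 * (M * \<bar>x\<bar>)))" by simp
    then have "1 / 2 \<le> exp (- ln 2 * M * \<bar>x\<bar>)" by (simp add: exp_minus mult.assoc)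
    then have "M * 1 \<le> M * (2 * exp (- ln 2 * M * \<bar>x\<bar>))" using M by (intro mult_left_mono) auto
    then show ?thesis using SLC_le_peak[OF f, of x] unfolding M_def[symmetric] by (simp add: ac_simps)
  next
    case False
    \<comment> \<open>\<open>t\<close> places \<open>1/M\<close> between the mode and \<open>\<bar>x\<bar>\<close>: \<open>1/M = (1 - t) * 0 + t * \<bar>x\<bar>\<close>.\<close>
    define t where "t = 1 / (M * \<bar>x\<bar>)"
    have t: "0 < t" "t < 1" using False M by (auto simp: t_def field_simps)
    have "integrable lborel (indicator {-1/M..1/M} :: real \<Rightarrow> real)" using M by (intro integrable_real_indicator) auto
    then have "(\<integral>z. f (1 / M) * indicator {-1/M..1/M} z \<partial>lborel) \<le> (\<integral>z. f z \<partial>lborel)"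
      using M by (intro integral_mono int integrable_mult_right)
        (auto split: split_indicator simp: SLC_nonneg[OF f] intro!: SLC_antimono[OF f])
    then have half: "f (1 / M) \<le> M / 2" using M one by (simp add: field_simps)
    have "f 0 powr (1 - t) * f \<bar>x\<bar> powr t \<le> f ((1 - t) * 0 + t * \<bar>x\<bar>)"
      by (rule SLC_log_concave[OF f t])
    also have "(1 - t) * 0 + t * \<bar>x\<bar> = 1 / M" using False M by (auto simp: t_def)
    finally have "M powr (1 - t) * f x powr t \<le> M / 2"
      using half by (simp add: M_def SLC_abs[OF f])
    then have "M powr t * (M powr (1 - t) * f x powr t) \<le> M powr t * (M / 2)"
      by (intro mult_left_mono) auto
    moreover have "M powr t * M powr (1 - t) = M"
      using M by (simp flip: powr_add)
    ultimately have "M * f x powr t \<le> M * (M powr t / 2)"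
      by (metis mult.assoc mult.commute times_divide_eq_right)
    then have "f x powr t \<le> M powr t / 2" using M by simp
    also have "\<dots> = (M * exp (- ln 2 * M * \<bar>x\<bar>)) powr t"
    proof -
      have "M * \<bar>x\<bar> \<noteq> 0" using t(1) by (auto simp: t_def)
      then have "M * \<bar>x\<bar> * t = 1" unfolding t_def
        by (metis nonzero_eq_divide_eq mult.commute)
      then have "- ln 2 * M * \<bar>x\<bar> * t = - ln (2::real)" by (simp add: mult.assoc)
      moreover have "(M * exp a) powr t = M powr t * exp (a * t)" for a
        using M by (simp add: powr_mult exp_powr_real)
      ultimately show ?thesis by (simp only: exp_minus exp_ln) simp
    qed
    finally have "f x powr t \<le> (M * exp (- ln 2 * M * \<bar>x\<bar>)) powr t" .
    then have "f x \<le> M * exp (- ln 2 * M * \<bar>x\<bar>)"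
      using powr_less_mono2[OF t(1), of "M * exp (- ln 2 * M * \<bar>x\<bar>)" "f x"] M by (force simp: not_le)
    also have "\<dots> \<le> 2 * M * exp (- ln 2 * M * \<bar>x\<bar>)" using M by simp
    finally show ?thesis by (simp add: M_def)
  qed
qed

section \<open>Maximizers of the criterion\<close>

lemma usc_ereal_iff:
  "usc_ereal \<psi> \<longleftrightarrow> (\<forall>x c. \<psi> x < c \<longrightarrow> (\<forall>\<^sub>F y in nhds x. \<psi> y < c))"
  unfolding usc_ereal_def Limsup_le_iff eventually_nhds_conv_at by blast

text \<open>The competitor in the likelihood comparison: the graph of \<open>f\<close> is cut at the mode and the halves
  are moved apart by \<open>2 d\<close>, the gap being filled at the height of the mode. It dominates every translate of \<open>f\<close> by at
  most \<open>d\<close>, in particular on the support of that translate. Used for \<open>\<psi>\<close> as well as for \<open>e\<^sup>\<psi>\<close>.\<close>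
definition widen :: "real \<Rightarrow> (real \<Rightarrow> 'a) \<Rightarrow> real \<Rightarrow> 'a" where
  "widen d f x = f (max (\<bar>x\<bar> - d) 0)"

text \<open>Concavity survives because \<open>\<bar>x\<bar> \<mapsto> max (\<bar>x\<bar> - d) 0\<close> is convex and \<open>\<psi>\<close> is decreasing on the half line;
  upper semicontinuity survives because that map is continuous.\<close>
lemma SC_widen:
  assumes "\<psi> \<in> SC" "0 \<le> d"
  shows "widen d \<psi> \<in> SC"
proof -
  define s where "s x = max (\<bar>x\<bar> - d) 0" for x :: real
  have [simp]: "0 \<le> s x" for x by (simp add: s_def)
  have s_convex: "s ((1 - t) * x + t * y) \<le> (1 - t) * s x + t * s y" if "0 < t" "t < 1" for t x y
  proof -
    have "\<bar>(1 - t) * x + t * y\<bar> \<le> (1 - t) * \<bar>x\<bar> + t * \<bar>y\<bar>"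
      using that by (intro order_trans[OF abs_triangle_ineq]) (auto simp: abs_mult)
    moreover have "(1 - t) * (\<bar>x\<bar> - d) \<le> (1 - t) * s x" "t * (\<bar>y\<bar> - d) \<le> t * s y"
      using that by (auto simp: s_def intro!: mult_left_mono)
    moreover have "0 \<le> (1 - t) * s x" "0 \<le> t * s y" using that by auto
    moreover have "(1 - t) * (\<bar>x\<bar> - d) + t * (\<bar>y\<bar> - d) = (1 - t) * \<bar>x\<bar> + t * \<bar>y\<bar> - d"
      by (simp add: algebra_simps)
    ultimately show ?thesis unfolding s_def[of "(1 - t) * x + t * y"] by linarith
  qed
  have "concave_ereal (\<lambda>x. \<psi> (s x))"
    unfolding concave_ereal_def
  proof (intro allI ballI)
    fix x y t :: real assume "t \<in> {0<..<1}"
    then have t: "0 < t" "t < 1" by auto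
    have "ereal (1 - t) * \<psi> (s x) + ereal t * \<psi> (s y) \<le> \<psi> ((1 - t) * s x + t * s y)"
      by (rule SC_concave[OF assms(1) t])
    also have "\<dots> \<le> \<psi> (s ((1 - t) * x + t * y))"
      using s_convex[OF t, of x y] by (intro SC_antimono[OF assms(1)]) (auto simp: abs_of_nonneg)
    finally show "ereal (1 - t) * \<psi> (s x) + ereal t * \<psi> (s y) \<le> \<psi> (s ((1 - t) * x + t * y))" .
  qed
  moreover have "usc_ereal (\<lambda>x. \<psi> (s x))"
    unfolding usc_ereal_iff
  proof (intro allI impI)
    fix x c assume "\<psi> (s x) < c"
    then have "\<forall>\<^sub>F y in nhds (s x). \<psi> y < c"
      using assms unfolding SC_def usc_ereal_iff by blast
    moreover have "filterlim s (nhds (s x)) (nhds x)"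
      unfolding s_def by (auto intro!: tendsto_intros filterlim_ident)
    ultimately show "\<forall>\<^sub>F y in nhds x. \<psi> (s y) < c"
      by (rule eventually_compose_filterlim)
  qed
  moreover have "\<psi> 0 \<noteq> -\<infinity>"
    using assms SC_antimono[OF assms(1), of 0] by (auto simp: SC_def)
  then have "\<psi> (s 0) \<noteq> -\<infinity>"
    using assms(2) by (simp add: s_def)
  moreover have "s (-x) = s x" for x by (simp add: s_def)
  ultimately have "(\<lambda>x. \<psi> (s x)) \<in> SC"
    using assms(1) unfolding SC_def by auto
  moreover have "widen d \<psi> = (\<lambda>x. \<psi> (s x))" by (simp add: fun_eq_iff widen_def s_def)
  ultimately show ?thesis by simp
qed

lemma SLC_widen: "f \<in> SLC \<Longrightarrow> 0 \<le> d \<Longrightarrow> widen d f \<in> SLC"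
  by (auto simp: SLC_def widen_def intro!: bexI[OF _ SC_widen])

lemma widen_shift_ge:
  assumes "f \<in> SLC" "\<bar>u - v\<bar> \<le> d"
  shows "f (x - v) \<le> widen d f (x - u)"
  unfolding widen_def using assms(2) by (intro SLC_antimono[OF assms(1)]) linarith

text \<open>The inserted plateau of width \<open>2 d\<close> and height \<open>f 0\<close> is all that widening adds to the integral.\<close>
lemma widen_integral:
  assumes f: "f \<in> SLC" and int: "integrable lborel f" and d: "0 \<le> d"
  shows "integrable lborel (widen d f)" "(\<integral>x. widen d f x \<partial>lborel) \<le> (\<integral>x. f x \<partial>lborel) + 2 * d * f 0"
proof -
  define p where "p x = indicator {0<..} x * f x" for x
  define m where "m x = indicator {..<0} x * f x" for x
  note [measurable] = SLC_borel_measurable[OF f]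
  have pm: "integrable lborel p" "integrable lborel m"
    unfolding p_def m_def
    by (rule Bochner_Integration.integrable_bound[OF int]; auto simp: indicator_def)+
  have shift: "integrable lborel (\<lambda>x. p (-d + x))" "integrable lborel (\<lambda>x. m (d + x))"
    using lborel_integrable_real_affine[OF pm(1), of 1 "-d"] lborel_integrable_real_affine[OF pm(2), of 1 d]
    by simp_all
  \<comment> \<open>The pieces of \<open>widen d f\<close>: the right half of \<open>f\<close>, the left half of \<open>f\<close>, and the plateau.\<close>
  have eq: "widen d f = (\<lambda>x. p (-d + x) + m (d + x) + f 0 * indicator {-d..d} x)"
  proof
    fix x
    consider "x < -d" | "-d \<le> x" "x \<le> d" | "x > d" by linarith
    then show "widen d f x = p (-d + x) + m (d + x) + f 0 * indicator {-d..d} x"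
    proof cases
      case 1
      have "- x - d = - (d + x)" by simp
      then have "f (- x - d) = f (d + x)" by (simp only: SLC_even[OF f])
      with 1 d show ?thesis by (simp add: widen_def p_def m_def indicator_def max_def)
    qed (use d in \<open>auto simp: widen_def p_def m_def indicator_def max_def\<close>)
  qed
  have box: "integrable lborel (\<lambda>x. f 0 * indicator {-d..d} x)"
    using d by (intro integrable_mult_right integrable_real_indicator) auto
  show "integrable lborel (widen d f)" unfolding eq using shift box by auto
  have "(\<integral>x. widen d f x \<partial>lborel) = (\<integral>x. p x \<partial>lborel) + (\<integral>x. m x \<partial>lborel) + 2 * d * f 0"
    unfolding eq using shift box d
      lborel_integral_real_affine[of 1 p "-d"] lborel_integral_real_affine[of 1 m d]
    by simp
  also have "(\<integral>x. p x \<partial>lborel) + (\<integral>x. m x \<partial>lborel) = (\<integral>x. p x + m x \<partial>lborel)"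
    using pm by simp
  also have "\<dots> \<le> (\<integral>x. f x \<partial>lborel)"
    by (intro integral_mono Bochner_Integration.integrable_add pm int) (auto simp: p_def m_def indicator_def SLC_nonneg[OF f])
  finally show "(\<integral>x. widen d f x \<partial>lborel) \<le> (\<integral>x. f x \<partial>lborel) + 2 * d * f 0" by simp
qed

lemma SLC_scale:
  assumes "f \<in> SLC" "0 < c"
  shows "(\<lambda>x. c * f x) \<in> SLC"
proof -
  obtain \<psi> where \<psi>: "\<psi> \<in> SC" and f: "f = (\<lambda>x. exp_ereal (\<psi> x))"
    using assms(1) by (auto simp: SLC_def)
  have fin: "\<psi> x \<noteq> \<infinity>" for x using \<psi> by (auto simp: SC_def)
  let ?\<phi> = "\<lambda>x. \<psi> x + ereal (ln c)"
  have "concave_ereal ?\<phi>"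
    unfolding concave_ereal_def
  proof (intro allI ballI)
    fix x y t :: real assume "t \<in> {0<..<1}"
    then have t: "0 < t" "t < 1" by auto
    have "ereal (1 - t) * ?\<phi> x + ereal t * ?\<phi> y = ereal (1 - t) * \<psi> x + ereal t * \<psi> y + ereal (ln c)"
      using fin[of x] fin[of y] t by (cases "\<psi> x"; cases "\<psi> y") (auto simp: algebra_simps)
    also have "\<dots> \<le> ?\<phi> ((1 - t) * x + t * y)"
      by (intro add_right_mono SC_concave[OF \<psi> t])
    finally show "ereal (1 - t) * ?\<phi> x + ereal t * ?\<phi> y \<le> ?\<phi> ((1 - t) * x + t * y)" .
  qed
  moreover have "usc_ereal ?\<phi>"
    unfolding usc_ereal_iff
  proof (intro allI impI)
    fix x a assume "?\<phi> x < a"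
    have shift: "b + ereal (ln c) < a \<longleftrightarrow> b < a - ereal (ln c)" for b
      by (cases a; cases b) auto
    have "\<psi> x < a - ereal (ln c)" using \<open>?\<phi> x < a\<close> unfolding shift .
    then show "\<forall>\<^sub>F y in nhds x. ?\<phi> y < a"
      using \<psi> unfolding shift SC_def usc_ereal_iff by blast
  qed
  ultimately have "?\<phi> \<in> SC" using \<psi> by (auto simp: SC_def)
  moreover have "exp_ereal (?\<phi> x) = c * f x" for x
    using fin[of x] assms(2) by (cases "\<psi> x") (auto simp: f exp_ereal_def exp_add)
  ultimately show ?thesis unfolding SLC_def by (auto intro!: bexI[of _ ?\<phi>])
qed

definition empirical_mean :: "nat \<Rightarrow> (nat \<Rightarrow> 'a) \<Rightarrow> ('a \<Rightarrow> real) \<Rightarrow> real" where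
  "empirical_mean n x h = (\<Sum>i<n. h (x i)) / real n"

lemma empirical_mean_mono: "(\<And>i. i < n \<Longrightarrow> h (x i) \<le> k (x i)) \<Longrightarrow> empirical_mean n x h \<le> empirical_mean n x k"
  unfolding empirical_mean_def by (intro divide_right_mono sum_mono) auto

lemma empirical_mean_add: "empirical_mean n x (\<lambda>z. h z + k z) = empirical_mean n x h + empirical_mean n x k"
  by (simp add: empirical_mean_def sum.distrib add_divide_distrib)

lemma empirical_mean_cmult: "empirical_mean n x (\<lambda>z. c * h z) = c * empirical_mean n x h"
  by (simp add: empirical_mean_def sum_distrib_left)

lemma empirical_mean_const: "0 < n \<Longrightarrow> empirical_mean n x (\<lambda>z. c) = c"
  by (simp add: empirical_mean_def)

lemma Phi_real:
  assumes "0 < n" "f = (\<lambda>z. exp_ereal (\<psi> z))" "f \<in> SLC" "integrable lborel f"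
    and "\<And>i. i < n \<Longrightarrow> 0 < mix \<pi> u1 u2 f (x i)"
  shows "Phi n x \<pi> u1 u2 \<psi> = ereal (empirical_mean n x (\<lambda>z. ln (mix \<pi> u1 u2 f z)) - (\<integral>z. f z \<partial>lborel))"
proof -
  have "(\<integral>\<^sup>+z. ennreal (f z) \<partial>lborel) = ennreal (\<integral>z. f z \<partial>lborel)"
    using assms by (intro nn_integral_eq_integral) (auto simp: SLC_nonneg)
  moreover have "(\<Sum>i<n. ln_ereal (mix \<pi> u1 u2 f (x i))) = ereal (\<Sum>i<n. ln (mix \<pi> u1 u2 f (x i)))"
    unfolding sum_ereal[symmetric] using assms(5)
    by (intro sum.cong refl) (auto simp: ln_ereal_def not_le[symmetric])
  moreover have "0 \<le> (\<integral>z. f z \<partial>lborel)" using assms(3) by (simp add: SLC_nonneg)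
  ultimately show ?thesis
    unfolding Phi_def empirical_mean_def assms(2)[symmetric, THEN fun_cong] by (simp add: enn2ereal_ennreal)
qed

text \<open>A finite criterion value rules out both degenerate cases, an observation of density \<open>0\<close> and an infinite
  integral; beyond this point the argument is about real numbers only.\<close>
lemma Phi_finite_imp:
  assumes "0 < n" "f = (\<lambda>z. exp_ereal (\<psi> z))" "f \<in> SLC" "Phi n x \<pi> u1 u2 \<psi> \<noteq> -\<infinity>"
  shows "integrable lborel f" "\<And>i. i < n \<Longrightarrow> 0 < mix \<pi> u1 u2 f (x i)"
proof -
  define S where "S = (\<Sum>i<n. ln_ereal (mix \<pi> u1 u2 f (x i)))"
  define I where "I = enn2ereal (\<integral>\<^sup>+z. ennreal (f z) \<partial>lborel)"
  have Phi: "Phi n x \<pi> u1 u2 \<psi> = ereal (1 / real n) * S - I"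
    by (simp add: Phi_def S_def I_def assms(2))
  have "0 \<le> I" by (simp add: I_def)
  have S_fin: "S \<noteq> \<infinity>" by (auto simp: S_def sum_Pinfty ln_ereal_def)
  show "0 < mix \<pi> u1 u2 f (x i)" if "i < n" for i
  proof (rule ccontr)
    assume "\<not> ?thesis"
    then have "ln_ereal (mix \<pi> u1 u2 f (x i)) = -\<infinity>" by (simp add: ln_ereal_def)
    then have "S = -\<infinity>" 
      using that unfolding S_def
      by (subst sum.remove[of _ i]) (auto simp: sum_Pinfty ln_ereal_def)
    then show False using assms(1,4) \<open>0 \<le> I\<close> unfolding Phi by (cases I) auto
  qed
  have "I \<noteq> \<infinity>"
    using assms(1,4) S_fin unfolding Phi by (cases S) auto
  then have "(\<integral>\<^sup>+z. ennreal (f z) \<partial>lborel) < \<infinity>"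
    unfolding I_def by (auto simp: less_top enn2ereal_eq_top_iff)
  then show "integrable lborel f"
    using SLC_borel_measurable[OF assms(3)] SLC_nonneg[OF assms(3)] by (intro integrableI_nonneg) auto
qed

text \<open>One competitor with a finite criterion value suffices to make the criterion finite at the maximizer.\<close>
lemma MLE_maximizes:
  assumes mle: "is_MLE n x \<pi> u1 u2 \<psi>" and f: "f = (\<lambda>z. exp_ereal (\<psi> z))" and n: "0 < n"
    and h: "h \<in> SLC" "integrable lborel h" "\<And>i. i < n \<Longrightarrow> 0 < mix \<pi> u1 u2 h (x i)"
  shows "f \<in> SLC" "integrable lborel f" "\<And>i. i < n \<Longrightarrow> 0 < mix \<pi> u1 u2 f (x i)"
    "empirical_mean n x (\<lambda>z. ln (mix \<pi> u1 u2 h z)) - (\<integral>z. h z \<partial>lborel)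
      \<le> empirical_mean n x (\<lambda>z. ln (mix \<pi> u1 u2 f z)) - (\<integral>z. f z \<partial>lborel)"
proof -
  show slc: "f \<in> SLC" using mle by (auto simp: SLC_def is_MLE_def f)
  obtain \<phi> where \<phi>: "\<phi> \<in> SC" "h = (\<lambda>z. exp_ereal (\<phi> z))" using h(1) by (auto simp: SLC_def)
  have le: "Phi n x \<pi> u1 u2 \<phi> \<le> Phi n x \<pi> u1 u2 \<psi>" using mle \<phi> by (auto simp: is_MLE_def)
  have hP: "Phi n x \<pi> u1 u2 \<phi> = ereal (empirical_mean n x (\<lambda>z. ln (mix \<pi> u1 u2 h z)) - (\<integral>z. h z \<partial>lborel))"
    by (rule Phi_real[OF n \<phi>(2) h])
  then have "Phi n x \<pi> u1 u2 \<psi> \<noteq> -\<infinity>" using le by auto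
  note fin = Phi_finite_imp[OF n f slc this]
  show "integrable lborel f" "\<And>i. i < n \<Longrightarrow> 0 < mix \<pi> u1 u2 f (x i)" by (fact fin)+
  have fP: "Phi n x \<pi> u1 u2 \<psi> = ereal (empirical_mean n x (\<lambda>z. ln (mix \<pi> u1 u2 f z)) - (\<integral>z. f z \<partial>lborel))"
    by (rule Phi_real[OF n f slc fin(1)]) (rule fin(2))
  show "empirical_mean n x (\<lambda>z. ln (mix \<pi> u1 u2 h z)) - (\<integral>z. h z \<partial>lborel)
      \<le> empirical_mean n x (\<lambda>z. ln (mix \<pi> u1 u2 f z)) - (\<integral>z. f z \<partial>lborel)"
    using le unfolding hP fP by simp
qed

lemma mix_cmult: "mix \<pi> u1 u2 (\<lambda>z. c * f z) x = c * mix \<pi> u1 u2 f x"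
  by (simp add: mix_def algebra_simps)

text \<open>Along the ray \<open>c * f\<close> the criterion is a constant plus \<open>ln c - c * I\<close>, with \<open>I\<close> the integral of \<open>f\<close>. Its maximum
  over \<open>c\<close> is attained at \<open>c = 1\<close> only if \<open>I = 1\<close>.\<close>
lemma MLE_integral_1:
  assumes mle: "is_MLE n x \<pi> u1 u2 \<psi>" and f: "f = (\<lambda>z. exp_ereal (\<psi> z))" and n: "0 < n"
    and h: "h \<in> SLC" "integrable lborel h" "\<And>i. i < n \<Longrightarrow> 0 < mix \<pi> u1 u2 h (x i)"
  shows "f \<in> SLC1"
proof -
  note fin = MLE_maximizes(1-3)[OF mle f n h]
  define I where "I = (\<integral>z. f z \<partial>lborel)"
  have I0: "0 \<le> I" using fin(1) by (simp add: I_def SLC_nonneg)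
  have scale: "ln c - c * I \<le> - I" if c: "0 < c" for c
  proof -
    have "empirical_mean n x (\<lambda>z. ln (mix \<pi> u1 u2 (\<lambda>z. c * f z) z)) = empirical_mean n x (\<lambda>z. ln c + ln (mix \<pi> u1 u2 f z))"
      unfolding empirical_mean_def mix_cmult using fin(3) c
      by (intro arg_cong2[of _ _ _ _ "(/)"] sum.cong refl ln_mult_pos) auto
    also have "\<dots> = ln c + empirical_mean n x (\<lambda>z. ln (mix \<pi> u1 u2 f z))"
      using n by (simp add: empirical_mean_add empirical_mean_const)
    finally show ?thesis
      using MLE_maximizes(4)[OF mle f n SLC_scale[OF fin(1) c]] fin(2,3) c
      by (simp add: mix_cmult I_def)
  qed
  \<comment> \<open>The function that is positive only at the mode has \<open>I = 0\<close>, but then doubling it would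
    improve the criterion.\<close>
  have "I \<noteq> 0" using scale[of 2] by auto
  with I0 have "0 < I" by simp
  then have "I - 1 \<le> ln I" using scale[of "1 / I"] by (simp add: ln_div)
  then have "I = 1" using \<open>0 < I\<close> ln_eq_minus_one[of I] ln_le_minus_one[of I] by simp
  with fin(1) show ?thesis by (simp add: SLC1_def I_def)
qed

text \<open>Comparing the maximizer with \<open>widen d f0\<close>: shifted by the estimated locations, this competitor still dominates
  \<open>f0\<close> shifted by the true locations, at the cost \<open>2 * d * f0 0\<close> in the integral; the estimated weight costs
  at most the factor \<open>1 - k\<close>. Hence the fitted density has almost the likelihood of the true one, also
  when the supports of \<open>f0\<close> at the true and at the estimated locations differ.\<close>
lemma MLE_loglik_lower_bound:
  assumes mle: "is_MLE n x \<pi> u1 u2 \<psi>" and f: "f = (\<lambda>z. exp_ereal (\<psi> z))" and n: "0 < n"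
    and f0: "f0 \<in> SLC1" and pi0: "0 \<le> \<pi>0" "\<pi>0 \<le> 1"
    and pos: "\<And>i. i < n \<Longrightarrow> 0 < mix \<pi>0 v1 v2 f0 (x i)"
    and d: "\<bar>u1 - v1\<bar> \<le> d" "\<bar>u2 - v2\<bar> \<le> d"
    and k: "k < 1" "(1 - k) * \<pi>0 \<le> \<pi>" "(1 - k) * (1 - \<pi>0) \<le> 1 - \<pi>"
  shows "f \<in> SLC1" "\<And>i. i < n \<Longrightarrow> 0 < mix \<pi> u1 u2 f (x i)"
    "empirical_mean n x (\<lambda>z. ln (mix \<pi>0 v1 v2 f0 z)) + ln (1 - k) - 2 * d * f0 0
      \<le> empirical_mean n x (\<lambda>z. ln (mix \<pi> u1 u2 f z))"
proof -
  have f0': "f0 \<in> SLC" "integrable lborel f0" "(\<integral>z. f0 z \<partial>lborel) = 1"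
    using f0 SLC1_integrable by (auto simp: SLC1_def)
  have d0: "0 \<le> d" using d by linarith
  have "0 \<le> (1 - k) * \<pi>0" "0 \<le> (1 - k) * (1 - \<pi>0)" using k(1) pi0 by auto
  then have pi: "0 \<le> \<pi>" "\<pi> \<le> 1" using k(2,3) by linarith+
  define h where "h = widen d f0"
  have h: "h \<in> SLC" "integrable lborel h" "(\<integral>z. h z \<partial>lborel) \<le> 1 + 2 * d * f0 0"
    using SLC_widen[OF f0'(1) d0] widen_integral[OF f0'(1,2) d0] f0'(3) by (auto simp: h_def)
  have mix_h: "(1 - k) * mix \<pi>0 v1 v2 f0 z \<le> mix \<pi> u1 u2 h z" for z
  proof -
    have "(1 - k) * \<pi>0 * f0 (z - v1) \<le> \<pi> * h (z - u1)"
      using k pi0 widen_shift_ge[OF f0'(1) d(1)] SLC_nonneg[OF f0'(1)]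
      by (intro mult_mono) (auto simp: h_def pi)
    moreover have "(1 - k) * (1 - \<pi>0) * f0 (z - v2) \<le> (1 - \<pi>) * h (z - u2)"
      using k pi0 widen_shift_ge[OF f0'(1) d(2)] SLC_nonneg[OF f0'(1)]
      by (intro mult_mono) (auto simp: h_def pi)
    ultimately show ?thesis by (simp add: mix_def algebra_simps)
  qed
  have pos': "0 < (1 - k) * mix \<pi>0 v1 v2 f0 (x i)" if "i < n" for i
    using pos[OF that] k by simp
  have h_pos: "0 < mix \<pi> u1 u2 h (x i)" if "i < n" for i
    using mix_h[of "x i"] pos'[OF that] by linarith
  show f1: "f \<in> SLC1" by (rule MLE_integral_1[OF mle f n h(1,2) h_pos])
  show "\<And>i. i < n \<Longrightarrow> 0 < mix \<pi> u1 u2 f (x i)"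
    by (rule MLE_maximizes(3)[OF mle f n h(1,2) h_pos])
  have "ln (1 - k) + empirical_mean n x (\<lambda>z. ln (mix \<pi>0 v1 v2 f0 z))
      = empirical_mean n x (\<lambda>z. ln (1 - k) + ln (mix \<pi>0 v1 v2 f0 z))"
    using n by (simp add: empirical_mean_add empirical_mean_const)
  also have "\<dots> \<le> empirical_mean n x (\<lambda>z. ln (mix \<pi> u1 u2 h z))"
  proof (rule empirical_mean_mono)
    fix i assume i: "i < n"
    have "ln (1 - k) + ln (mix \<pi>0 v1 v2 f0 (x i)) = ln ((1 - k) * mix \<pi>0 v1 v2 f0 (x i))"
      using pos[OF i] k by (simp add: ln_mult_pos)
    also have "\<dots> \<le> ln (mix \<pi> u1 u2 h (x i))"
      by (rule ln_mono[OF mix_h pos'[OF i]])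
    finally show "ln (1 - k) + ln (mix \<pi>0 v1 v2 f0 (x i)) \<le> ln (mix \<pi> u1 u2 h (x i))" .
  qed
  finally show "empirical_mean n x (\<lambda>z. ln (mix \<pi>0 v1 v2 f0 z)) + ln (1 - k) - 2 * d * f0 0
      \<le> empirical_mean n x (\<lambda>z. ln (mix \<pi> u1 u2 f z))"
    using MLE_maximizes(4)[OF mle f n h(1,2) h_pos] h(3) f1 by (simp add: SLC1_def)
qed

section \<open>Functions of bounded variation and empirical means\<close>

text \<open>A bound on the total variation of \<open>h\<close> as seen by the partition of the line into the cells \<open>{x. q x = k}\<close>,
  \<open>k \<le> N\<close>. The majorant \<open>r\<close> of the oscillations lets sums and Lipschitz images be handled without suprema.\<close>
definition cell_variation_le :: "(real \<Rightarrow> nat) \<Rightarrow> nat \<Rightarrow> (real \<Rightarrow> real) \<Rightarrow> real \<Rightarrow> bool" where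
  "cell_variation_le q N h V \<longleftrightarrow> (\<exists>r. (\<forall>k. 0 \<le> r k) \<and> (\<Sum>k\<le>N. r k) \<le> V \<and>
     (\<forall>x y. q x = q y \<longrightarrow> \<bar>h x - h y\<bar> \<le> r (q x)))"

text \<open>A monotone \<open>q\<close> makes the cells consecutive, so the oscillations of a monotone function over them telescope.\<close>
lemma cell_variation_mono:
  fixes M :: real
  assumes A: "mono A" "\<And>x. A x \<in> {0..M}" and q: "mono q"
  shows "cell_variation_le q N A M"
proof -
  \<comment> \<open>\<open>a k\<close> separates the values of \<open>A\<close> before cell \<open>k\<close> from those in cell \<open>k\<close> and later. Inserting \<open>M\<close> supplies
    the last separator, beyond all cells.\<close>
  define a where "a k = Inf (insert M {A x | x. k \<le> q x})" for k
  have M: "0 \<le> M" using A(2)[of 0] by simp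
  have bdd: "bdd_below (insert M {A x | x. k \<le> q x})" for k
    using A(2) by (intro bdd_belowI[of _ 0]) (auto simp: M)
  have a_range: "0 \<le> a k" "a k \<le> M" for k
    unfolding a_def using A(2) bdd
    by (intro cInf_greatest cInf_lower; auto simp: M)+
  have a_mono: "a k \<le> a (Suc k)" for k
    unfolding a_def by (intro cInf_superset_mono bdd) auto
  have lower: "a (q x) \<le> A x" for x
    unfolding a_def by (intro cInf_lower bdd) auto
  have upper: "A x \<le> a (Suc (q x))" for x
    unfolding a_def
  proof (intro cInf_greatest)
    fix z assume "z \<in> insert M {A y | y. Suc (q x) \<le> q y}"
    then show "A x \<le> z"
    proof
      assume "z = M" then show ?thesis using A(2)[of x] by simp
    next
      assume "z \<in> {A y | y. Suc (q x) \<le> q y}"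
      then obtain y where y: "z = A y" "Suc (q x) \<le> q y" by auto
      then have "x \<le> y" using q by (metis linear monoD not_less_eq_eq)
      then show ?thesis using A(1) y(1) by (simp add: monoD)
    qed
  qed simp
  show ?thesis
    unfolding cell_variation_le_def
  proof (intro exI[of _ "\<lambda>k. a (Suc k) - a k"] conjI allI impI)
    show "0 \<le> a (Suc k) - a k" for k using a_mono by simp
    have "(\<Sum>k\<le>N. a (Suc k) - a k) = a (Suc N) - a 0"
      using sum_lessThan_telescope[of a "Suc N"] by (simp add: lessThan_Suc_atMost)
    then show "(\<Sum>k\<le>N. a (Suc k) - a k) \<le> M" using a_range(1)[of 0] a_range(2)[of "Suc N"] by linarith
    show "\<bar>A x - A y\<bar> \<le> a (Suc (q x)) - a (q x)" if "q x = q y" for x y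
      using lower[of x] lower[of y] upper[of x] upper[of y] that by auto
  qed
qed

lemma cell_variation_dominated:
  assumes "cell_variation_le q N h V" "cell_variation_le q N k W" "0 \<le> a" "0 \<le> b"
    and "\<And>x y. \<bar>F x - F y\<bar> \<le> a * \<bar>h x - h y\<bar> + b * \<bar>k x - k y\<bar>"
  shows "cell_variation_le q N F (a * V + b * W)"
proof -
  obtain r s where r: "\<And>k. 0 \<le> r k" "(\<Sum>k\<le>N. r k) \<le> V" "\<And>x y. q x = q y \<Longrightarrow> \<bar>h x - h y\<bar> \<le> r (q x)"
    and s: "\<And>k. 0 \<le> s k" "(\<Sum>k\<le>N. s k) \<le> W" "\<And>x y. q x = q y \<Longrightarrow> \<bar>k x - k y\<bar> \<le> s (q x)"
    using assms(1,2) unfolding cell_variation_le_def by blast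
  show ?thesis
    unfolding cell_variation_le_def
  proof (intro exI[of _ "\<lambda>j. a * r j + b * s j"] conjI allI impI)
    show "0 \<le> a * r j + b * s j" for j using r(1) s(1) assms by simp
    show "(\<Sum>j\<le>N. a * r j + b * s j) \<le> a * V + b * W"
      unfolding sum.distrib sum_distrib_left[symmetric] using r(2) s(2) assms
      by (intro add_mono mult_left_mono) auto
    show "\<bar>F x - F y\<bar> \<le> a * r (q x) + b * s (q x)" if "q x = q y" for x y
      using r(3)[OF that] s(3)[OF that] assms
      by (intro order_trans[OF assms(5)] add_mono mult_left_mono) auto
  qed
qed

lemma cell_variation_SLC_shift:
  assumes "f \<in> SLC" "mono q"
  shows "cell_variation_le q N (\<lambda>x. f (x - u)) (2 * f 0)"
proof -
  have "cell_variation_le q N (\<lambda>x. f (x - u)) (1 * f 0 + 1 * f 0)"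
  proof (rule cell_variation_dominated)
    show "cell_variation_le q N (\<lambda>x. rise f (x - u)) (f 0)"
      "cell_variation_le q N (\<lambda>x. drop_off f (x - u)) (f 0)"
      using rise_drop_off_bounds[OF assms(1)] mono_rise[OF assms(1)] mono_drop_off[OF assms(1)] assms(2)
      by (auto intro!: cell_variation_mono simp: mono_def)
    show "\<bar>f (x - u) - f (y - u)\<bar> \<le> 1 * \<bar>rise f (x - u) - rise f (y - u)\<bar>
        + 1 * \<bar>drop_off f (x - u) - drop_off f (y - u)\<bar>" for x y
    proof -
      have "f (x - u) - f (y - u) = (rise f (x - u) - rise f (y - u)) - (drop_off f (x - u) - drop_off f (y - u))"
        using rise_minus_drop_off[of f "x - u"] rise_minus_drop_off[of f "y - u"] by linarith
      then show ?thesis by (simp only: mult_1 abs_triangle_ineq4)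
    qed
  qed auto
  then show ?thesis by simp
qed

text \<open>On each cell replace \<open>h\<close> by a constant, once from above under the empirical measure and once from below under
  \<open>g\<close>. The constants contribute only through the deviations of the cell frequencies, the oscillations only through the
  mass of the cells, which is uniformly small. This is uniform in \<open>h\<close>, given the bounds \<open>B\<close> and \<open>V\<close>.\<close>
lemma empirical_mean_le_integral_cells:
  assumes g: "integrable lborel g" "\<And>x. 0 \<le> g x"
    and q: "\<And>k. {x. q x = k} \<in> sets borel" "\<And>x. q x \<le> N"
    and mass: "\<And>k. k \<le> N \<Longrightarrow> (\<integral>x. g x * indicator {x. q x = k} x \<partial>lborel) \<le> p"
    and freq: "\<And>k. k \<le> N \<Longrightarrow> \<bar>empirical_mean n x (indicator {x. q x = k}) -
       (\<integral>x. g x * indicator {x. q x = k} x \<partial>lborel)\<bar> \<le> e" "e \<le> p"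
    and h: "h \<in> borel_measurable borel" "\<And>x. \<bar>h x\<bar> \<le> B" and V: "cell_variation_le q N h V"
  shows "empirical_mean n x h \<le> (\<integral>x. g x * h x \<partial>lborel) + (real N + 1) * e * B + 3 * p * V"
proof -
  define I where "I k = (indicator {x. q x = k} :: real \<Rightarrow> real)" for k
  define P where "P k = (\<integral>x. g x * I k x \<partial>lborel)" for k
  define E where "E k = empirical_mean n x (I k)" for k
  obtain r where r: "\<And>k. 0 \<le> r k" "(\<Sum>k\<le>N. r k) \<le> V" "\<And>x y. q x = q y \<Longrightarrow> \<bar>h x - h y\<bar> \<le> r (q x)"
    using V unfolding cell_variation_le_def by blast
  \<comment> \<open>If cell \<open>k\<close> is empty, \<open>c k\<close> is the value of \<open>h\<close> at an arbitrary point, which the bound \<open>B\<close> covers too.\<close>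
  define c where "c k = h (SOME y. q y = k)" for k
  have c_bd: "\<bar>c k\<bar> \<le> B" for k by (simp add: c_def h)
  have c: "\<bar>h y - c (q y)\<bar> \<le> r (q y)" for y
    unfolding c_def using someI[of "\<lambda>z. q z = q y" y] by (intro r(3)) simp
  have step: "(\<Sum>k\<le>N. w k * I k y) = w (q y)" for w y
  proof -
    have "(\<Sum>k\<le>N. w k * I k y) = (\<Sum>k\<le>N. if k = q y then w k else 0)"
      by (intro sum.cong) (auto simp: I_def)
    then show ?thesis using q(2)[of y] by simp
  qed
  have I_meas[measurable]: "I k \<in> borel_measurable borel" for k
    unfolding I_def using q(1) by (intro borel_measurable_indicator)
  note [measurable] = borel_measurable_integrable[OF g(1)] h(1)
  have gI: "integrable lborel (\<lambda>x. g x * I k x)" for k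
  proof (rule Bochner_Integration.integrable_bound[OF g(1)])
    show "AE x in lborel. norm (g x * I k x) \<le> norm (g x)" by (auto simp: I_def indicator_def)
  qed measurable
  have gh: "integrable lborel (\<lambda>x. g x * h x)"
    by (rule Bochner_Integration.integrable_bound[OF integrable_mult_left[OF g(1), of B]])
      (use g in \<open>auto simp: abs_mult intro!: AE_I2 mult_left_mono order_trans[OF h(2) abs_ge_self]\<close>)
  have B: "0 \<le> B" using h(2)[of 0] by linarith
  have "empirical_mean n x h \<le> empirical_mean n x (\<lambda>y. \<Sum>k\<le>N. (c k + r k) * I k y)"
    unfolding step using c by (intro empirical_mean_mono) (smt (verit))
  also have "\<dots> = (\<Sum>k\<le>N. (c k + r k) * E k)"
    unfolding empirical_mean_def E_def by (subst sum.swap) (simp add: sum_distrib_left sum_divide_distrib)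
  finally have up: "empirical_mean n x h \<le> (\<Sum>k\<le>N. (c k + r k) * E k)" .
  have "(\<Sum>k\<le>N. (c k - r k) * P k) = (\<integral>x. (\<Sum>k\<le>N. (c k - r k) * (g x * I k x)) \<partial>lborel)"
    unfolding P_def using gI by simp
  also have "\<dots> = (\<integral>x. g x * (\<Sum>k\<le>N. (c k - r k) * I k x) \<partial>lborel)"
    by (simp add: sum_distrib_left ac_simps)
  also have "\<dots> \<le> (\<integral>x. g x * h x \<partial>lborel)"
  proof (rule integral_mono)
    have "integrable lborel (\<lambda>x. \<Sum>k\<le>N. (c k - r k) * (g x * I k x))" using gI by simp
    then show "integrable lborel (\<lambda>x. g x * (\<Sum>k\<le>N. (c k - r k) * I k x))"
      by (simp add: sum_distrib_left ac_simps)
    show "g y * (\<Sum>k\<le>N. (c k - r k) * I k y) \<le> g y * h y" for y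
      unfolding step using c[of y] g(2) by (intro mult_left_mono) auto
  qed (rule gh)
  finally have low: "(\<Sum>k\<le>N. (c k - r k) * P k) \<le> (\<integral>x. g x * h x \<partial>lborel)" .
  have "(\<Sum>k\<le>N. (c k + r k) * E k) \<le> (\<Sum>k\<le>N. (c k - r k) * P k + e * B + 3 * p * r k)"
  proof (rule sum_mono)
    fix k assume "k \<in> {..N}"
    then have k: "P k \<le> p" "\<bar>E k - P k\<bar> \<le> e"
      using mass freq(1) by (auto simp: P_def E_def I_def)
    have "c k * (E k - P k) \<le> \<bar>c k\<bar> * \<bar>E k - P k\<bar>" by (simp flip: abs_mult)
    also have "\<dots> \<le> B * e" using c_bd k B by (intro mult_mono) auto
    finally have "c k * (E k - P k) \<le> B * e" .
    moreover have "r k * (E k + P k) \<le> r k * (3 * p)"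
      using k freq(2) r(1) by (intro mult_left_mono) auto
    ultimately show "(c k + r k) * E k \<le> (c k - r k) * P k + e * B + 3 * p * r k"
      by (simp add: algebra_simps)
  qed
  also have "\<dots> = (\<Sum>k\<le>N. (c k - r k) * P k) + (real N + 1) * e * B + 3 * p * (\<Sum>k\<le>N. r k)"
    unfolding sum.distrib sum_distrib_left[symmetric] by (simp add: mult.assoc add.commute)
  also have "3 * p * (\<Sum>k\<le>N. r k) \<le> 3 * p * V"
  proof -
    have "0 \<le> P 0" unfolding P_def I_def using g(2) by (intro integral_nonneg_AE) auto
    then have "0 \<le> p" using mass[of 0] by (simp add: P_def I_def)
    then show ?thesis using r(2) by (intro mult_left_mono) auto
  qed
  finally show ?thesis using up low by linarith
qed

text \<open>Cut \<open>[-R, R)\<close> into \<open>N\<close> intervals of length \<open>d\<close> and let the outer cells absorb the tails. A short interval has small mass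
  because the density is bounded, a tail because it is integrable. Truncation of negative integers by
  \<open>nat\<close> sends the left tail to cell \<open>0\<close>.\<close>
lemma small_cells_exist:
  fixes g :: "real \<Rightarrow> real"
  assumes g: "integrable lborel g" "\<And>x. 0 \<le> g x" "\<And>x. g x \<le> G" and p: "0 < p"
  obtains q :: "real \<Rightarrow> nat" and N where "mono q" "\<And>x. q x \<le> N" "\<And>k. {x. q x = k} \<in> sets borel"
    "\<And>k. (\<integral>x. g x * indicator {x. q x = k} x \<partial>lborel) \<le> p"
proof -
  note [measurable] = borel_measurable_integrable[OF g(1)]
  have gI: "integrable lborel (\<lambda>x. g x * indicator A x)" if "A \<in> sets borel" for A
    by (rule Bochner_Integration.integrable_bound[OF g(1)]) (use that in \<open>auto simp: indicator_def\<close>)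
  have "(\<lambda>m. \<integral>x. g x * indicator {x. real m \<le> \<bar>x\<bar>} x \<partial>lborel) \<longlonglongrightarrow> (\<integral>x. 0 \<partial>(lborel :: real measure))"
  proof (rule integral_dominated_convergence[where w = g])
    show "AE x in lborel. (\<lambda>m. g x * indicator {x. real m \<le> \<bar>x\<bar>} x) \<longlonglongrightarrow> 0"
    proof (rule AE_I2)
      fix x :: real
      obtain m0 :: nat where "\<bar>x\<bar> < m0" using reals_Archimedean2 by blast
      then have "\<forall>\<^sub>F m in sequentially. g x * indicator {x. real m \<le> \<bar>x\<bar>} x = 0"
        by (intro eventually_sequentiallyI[of m0]) (auto simp: indicator_def)
      then show "(\<lambda>m. g x * indicator {x. real m \<le> \<bar>x\<bar>} x) \<longlonglongrightarrow> 0" by (rule tendsto_eventually)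
    qed
  qed (use g in \<open>auto simp: indicator_def\<close>)
  then have "\<forall>\<^sub>F m in sequentially. (\<integral>x. g x * indicator {x. real m \<le> \<bar>x\<bar>} x \<partial>lborel) < p / 2"
    using p by (intro order_tendstoD(2)) auto
  then obtain m where m: "\<And>j. m \<le> j \<Longrightarrow> (\<integral>x. g x * indicator {x. real j \<le> \<bar>x\<bar>} x \<partial>lborel) < p / 2"
    unfolding eventually_sequentially by blast
  define R where "R = real (max m 1)"
  have R: "0 < R" "(\<integral>x. g x * indicator {x. R \<le> \<bar>x\<bar>} x \<partial>lborel) \<le> p / 2"
    unfolding R_def using m[of "max m 1"] by auto
  obtain N :: nat where N: "4 * R * G / p < N" using reals_Archimedean2 by blast
  have G: "0 \<le> G" using g(2,3)[of 0] by linarith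
  have "0 \<le> 4 * R * G / p" using R G p by simp
  then have N0: "0 < real N" using N by linarith
  define d where "d = 2 * R / N"
  have d: "0 < d" "N * d = 2 * R" "G * d \<le> p / 2"
    using R N0 N p by (auto simp: d_def field_simps)
  define q where "q x = min N (nat \<lfloor>(x + R) / d\<rfloor>)" for x
  have q_mono: "mono q"
    unfolding q_def using d(1) by (intro monoI min.mono nat_mono floor_mono divide_right_mono) auto
  have q_meas: "{x. q x = k} \<in> sets borel" for k
  proof -
    have "(\<lambda>x. real (q x)) \<in> borel_measurable borel"
      using q_mono by (intro borel_measurable_mono) (auto simp: mono_def)
    then have "{x \<in> space borel. real (q x) = real k} \<in> sets borel" by measurable
    then show ?thesis by simp
  qed
  have cell: "q x = k \<Longrightarrow> R \<le> \<bar>x\<bar> \<or> x \<in> {-R + k * d..-R + (real k + 1) * d}" for x k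
  proof -
    assume k: "q x = k"
    show ?thesis
    proof (cases "R \<le> \<bar>x\<bar>")
      case False
      then have "x + R < N * d" "0 \<le> x + R" using d(2) by linarith+
      then have "(x + R) / d < N" "0 \<le> (x + R) / d"
        using d(1) by (auto simp: pos_divide_less_eq)
      then have "nat \<lfloor>(x + R) / d\<rfloor> < N" by linarith
      then have "k = nat \<lfloor>(x + R) / d\<rfloor>" using k unfolding q_def by simp
      then have "real k = of_int \<lfloor>(x + R) / d\<rfloor>" using \<open>0 \<le> (x + R) / d\<close> by simp
      then have "real k \<le> (x + R) / d" "(x + R) / d \<le> real k + 1" by linarith+
      then have "k * d \<le> x + R" "x + R \<le> (real k + 1) * d"
        using d(1) by (simp_all add: pos_le_divide_eq pos_divide_le_eq)
      then show ?thesis by (simp add: algebra_simps)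
    qed simp
  qed
  have mass: "(\<integral>x. g x * indicator {x. q x = k} x \<partial>lborel) \<le> p" for k
  proof -
    let ?J = "{-R + k * d..-R + (real k + 1) * d}"
    have J: "integrable lborel (\<lambda>x. G * indicator ?J x)"
      using d(1) by (intro integrable_mult_right integrable_real_indicator) auto
    have T: "integrable lborel (\<lambda>x. g x * indicator {x. R \<le> \<bar>x\<bar>} x)"
      by (rule gI) measurable
    have "(\<integral>x. g x * indicator {x. q x = k} x \<partial>lborel)
        \<le> (\<integral>x. g x * indicator {x. R \<le> \<bar>x\<bar>} x + G * indicator ?J x \<partial>lborel)"
    proof (rule integral_mono)
      fix x
      have "indicator {x. q x = k} x \<le> indicator {x. R \<le> \<bar>x\<bar>} x + (indicator ?J x :: real)"
        using cell[of x k] by (auto simp: indicator_def)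
      then have "g x * indicator {x. q x = k} x \<le> g x * (indicator {x. R \<le> \<bar>x\<bar>} x + indicator ?J x)"
        using g(2) by (intro mult_left_mono) auto
      also have "\<dots> = g x * indicator {x. R \<le> \<bar>x\<bar>} x + g x * indicator ?J x" by (simp add: algebra_simps)
      also have "\<dots> \<le> g x * indicator {x. R \<le> \<bar>x\<bar>} x + G * indicator ?J x"
        using g(3) by (intro add_left_mono mult_right_mono) auto
      finally show "g x * indicator {x. q x = k} x \<le> g x * indicator {x. R \<le> \<bar>x\<bar>} x + G * indicator ?J x" .
    qed (use gI[OF q_meas] J T in auto)
    also have "\<dots> = (\<integral>x. g x * indicator {x. R \<le> \<bar>x\<bar>} x \<partial>lborel) + G * d"
      using J T d(1) by (simp add: algebra_simps)
    also have "\<dots> \<le> p" using R(2) d(3) by linarith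
    finally show ?thesis .
  qed
  show thesis
    by (rule that[of q N, OF q_mono _ q_meas mass]) (simp add: q_def)
qed

section \<open>Integrability of the mixture density and its logarithm\<close>

lemma integrable_exp_neg_abs:
  assumes "0 < a"
  shows "integrable lborel (\<lambda>x. exp (- a * \<bar>x\<bar>) :: real)"
proof -
  have e: "integrable lborel (exponential_density a)"
  proof (rule integrableI_nonneg)
    have "(\<integral>\<^sup>+x. ennreal (exponential_density a x) \<partial>lborel) = emeasure (density lborel (exponential_density a)) UNIV"
      by (simp add: emeasure_density)
    also have "\<dots> = 1"
      using prob_space.emeasure_space_1[OF prob_space_exponential_density[OF assms]] by simp
    finally show "(\<integral>\<^sup>+x. ennreal (exponential_density a x) \<partial>lborel) < \<infinity>" by simp
  qed (use assms in \<open>auto simp: exponential_density_nonneg\<close>)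
  have e': "integrable lborel (\<lambda>x. exponential_density a (- x))"
    using lborel_integrable_real_affine[OF e, of "-1" 0] by simp
  have "integrable lborel (\<lambda>x. (exponential_density a x + exponential_density a (- x)) / a)"
    using e e' by simp
  then show ?thesis
  proof (rule Bochner_Integration.integrable_bound)
    show "AE x in lborel. norm (exp (- a * \<bar>x\<bar>)) \<le> norm ((exponential_density a x + exponential_density a (- x)) / a)"
      using assms by (intro AE_I2) (auto simp: exponential_density_def field_simps abs_if)
  qed measurable
qed

lemma SLC1_integrable_sqrt:
  assumes "f \<in> SLC1"
  shows "integrable lborel (\<lambda>x. sqrt (f x))"
proof -
  have f: "f \<in> SLC" using assms by (simp add: SLC1_def)
  note [measurable] = SLC_borel_measurable[OF f]
  define a where "a = ln 2 * f 0 / 2"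
  have a: "0 < a" using SLC_peak_pos[OF f] by (simp add: a_def)
  have "integrable lborel (\<lambda>x. sqrt (2 * f 0) * exp (- a * \<bar>x\<bar>))"
    using integrable_exp_neg_abs[OF a] by simp
  then show ?thesis
  proof (rule Bochner_Integration.integrable_bound)
    have "sqrt (f x) \<le> sqrt (2 * f 0) * exp (- a * \<bar>x\<bar>)" for x
    proof -
      have "f x \<le> 2 * f 0 * exp (- a * \<bar>x\<bar>) ^ 2"
        using SLC1_exp_decay[OF assms, of x] by (simp add: a_def mult_exp_exp power2_eq_square ac_simps)
      then have "sqrt (f x) \<le> sqrt (2 * f 0 * exp (- a * \<bar>x\<bar>) ^ 2)" by (rule real_sqrt_le_mono)
      then show ?thesis by (simp add: real_sqrt_mult)
    qed
    then show "AE x in lborel. norm (sqrt (f x)) \<le> norm (sqrt (2 * f 0) * exp (- a * \<bar>x\<bar>))"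
      using SLC_nonneg[OF f] by (intro AE_I2) (simp add: abs_of_nonneg SLC_nonneg[OF f])
  qed measurable
qed

lemma mix_nonneg: "f \<in> SLC \<Longrightarrow> 0 \<le> \<pi> \<Longrightarrow> \<pi> \<le> 1 \<Longrightarrow> 0 \<le> mix \<pi> u1 u2 f x"
  by (simp add: mix_def SLC_nonneg)

lemma mix_le:
  assumes "0 \<le> \<pi>" "\<pi> \<le> 1" "f (x - u1) \<le> C" "f (x - u2) \<le> C"
  shows "mix \<pi> u1 u2 f x \<le> C"
  unfolding mix_def using assms by (intro convex_bound_le) auto

lemma mix_measurable [measurable (raw)]:
  assumes [measurable]: "f \<in> borel_measurable borel"
  shows "mix \<pi> u1 u2 f \<in> borel_measurable borel"
  unfolding mix_def[abs_def] by measurable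

lemma integrable_shift:
  "integrable lborel (f :: real \<Rightarrow> real) \<Longrightarrow> integrable lborel (\<lambda>x. f (x - u))"
  "(\<integral>x. f (x - u) \<partial>lborel) = (\<integral>x. f x \<partial>lborel)"
  using lborel_integrable_real_affine[of f 1 "-u"] lborel_integral_real_affine[of 1 f "-u"] by simp_all

lemma mix_integral:
  assumes "f \<in> SLC1"
  shows "integrable lborel (mix \<pi> u1 u2 f)" "(\<integral>x. mix \<pi> u1 u2 f x \<partial>lborel) = 1"
  using integrable_shift[of f u1] integrable_shift[of f u2] SLC1_integrable[OF assms] assms
  unfolding mix_def[abs_def] by (auto simp: SLC1_def)

lemma mix_integrable_sqrt:
  assumes f: "f \<in> SLC1" and pi: "0 \<le> \<pi>" "\<pi> \<le> 1"
  shows "integrable lborel (\<lambda>x. sqrt (mix \<pi> u1 u2 f x))"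
proof -
  have f': "f \<in> SLC" using f by (simp add: SLC1_def)
  note [measurable] = SLC_borel_measurable[OF f']
  have "integrable lborel (\<lambda>x. sqrt (f (x - u1)) + sqrt (f (x - u2)))"
    using integrable_shift(1)[OF SLC1_integrable_sqrt[OF f]] by simp
  then show ?thesis
  proof (rule Bochner_Integration.integrable_bound)
    have "sqrt (mix \<pi> u1 u2 f x) \<le> sqrt (f (x - u1)) + sqrt (f (x - u2))" for x
    proof -
      have "mix \<pi> u1 u2 f x \<le> 1 * f (x - u1) + 1 * f (x - u2)"
        unfolding mix_def using pi SLC_nonneg[OF f'] by (intro add_mono mult_right_mono) auto
      then have "sqrt (mix \<pi> u1 u2 f x) \<le> sqrt (f (x - u1) + f (x - u2))" by simp
      also have "\<dots> \<le> sqrt (f (x - u1)) + sqrt (f (x - u2))"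
        using SLC_nonneg[OF f'] by (intro sqrt_add_le_add_sqrt) auto
      finally show ?thesis .
    qed
    then show "AE x in lborel. norm (sqrt (mix \<pi> u1 u2 f x)) \<le> norm (sqrt (f (x - u1)) + sqrt (f (x - u2)))"
      using mix_nonneg[OF f' pi] SLC_nonneg[OF f'] by (intro AE_I2) simp
  qed measurable
qed

text \<open>For \<open>t \<le> 1\<close> put \<open>s = t\<^sup>1\<^sup>/\<^sup>4\<close>, so that \<open>t (ln t)\<^sup>2 = 16 s\<^sup>2 (s ln s)\<^sup>2\<close>, where \<open>\<bar>s ln s\<bar> \<le> 1\<close> and \<open>s\<^sup>2 = sqrt t\<close>.\<close>
lemma mult_ln_squared_le:
  fixes t :: real
  assumes "0 \<le> t" "t \<le> G"
  shows "t * (ln t)\<^sup>2 \<le> 16 * sqrt t + (ln G)\<^sup>2 * t"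
proof (cases "t \<le> 1")
  case True
  show ?thesis
  proof (cases "t = 0")
    case False
    then have t: "0 < t" using assms by simp
    define s where "s = sqrt (sqrt t)"
    have s: "0 < s" "s \<le> 1" "s ^ 2 = sqrt t" "s ^ 4 = t"
      using t True by (auto simp: s_def power4_eq_xxxx mult.assoc)
    have "ln (1 / s) \<le> 1 / s - 1" using s by (intro ln_le_minus_one) auto
    then have "- ln s \<le> 1 / s" using s by (simp add: ln_div)
    then have "s * (- ln s) \<le> s * (1 / s)" using s by (intro mult_left_mono) auto
    then have "- (s * ln s) \<le> 1" using s by simp
    moreover have "0 \<le> - (s * ln s)" using s by (simp add: mult_le_0_iff)
    ultimately have "(- (s * ln s)) ^ 2 \<le> 1" by (intro power_le_one)
    then have *: "(s * ln s) ^ 2 \<le> 1" by simp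
    have "ln (s ^ 4) = 4 * ln s" using s(1) by (simp add: ln_realpow)
    then have "ln t = 4 * ln s" by (simp only: s(4))
    then have "t * (ln t)\<^sup>2 = s ^ 4 * (4 * ln s)\<^sup>2" by (simp only: s(4))
    also have "\<dots> = 16 * s ^ 2 * (s * ln s) ^ 2" by algebra
    also have "\<dots> \<le> 16 * s ^ 2 * 1" using * by (intro mult_left_mono) auto
    finally have "t * (ln t)\<^sup>2 \<le> 16 * sqrt t" using s by simp
    also have "\<dots> \<le> 16 * sqrt t + (ln G)\<^sup>2 * t" using t by simp
    finally show ?thesis .
  qed simp
next
  case False
  then have "0 \<le> ln t" "ln t \<le> ln G" using assms by auto
  then have "t * (ln t)\<^sup>2 \<le> t * (ln G)\<^sup>2" using assms by (intro mult_left_mono power_mono) auto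
  moreover have "0 \<le> 16 * sqrt t" using assms by simp
  ultimately show ?thesis unfolding mult.commute[of "(ln G)\<^sup>2"] by linarith
qed

text \<open>The log-likelihood of a single observation has a finite second moment: the density is bounded and has an integrable
  square root.\<close>
lemma mix_integrable_ln_squared:
  assumes f: "f \<in> SLC1" and pi: "0 \<le> \<pi>" "\<pi> \<le> 1"
  shows "integrable lborel (\<lambda>x. mix \<pi> u1 u2 f x * (ln (mix \<pi> u1 u2 f x))\<^sup>2)"
proof -
  have f': "f \<in> SLC" using f by (simp add: SLC1_def)
  note [measurable] = SLC_borel_measurable[OF f']
  have "integrable lborel (\<lambda>x. 16 * sqrt (mix \<pi> u1 u2 f x) + (ln (f 0))\<^sup>2 * mix \<pi> u1 u2 f x)"
    using mix_integrable_sqrt[OF f pi] mix_integral(1)[OF f] by simp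
  then show ?thesis
  proof (rule Bochner_Integration.integrable_bound)
    show "AE x in lborel. norm (mix \<pi> u1 u2 f x * (ln (mix \<pi> u1 u2 f x))\<^sup>2)
      \<le> norm (16 * sqrt (mix \<pi> u1 u2 f x) + (ln (f 0))\<^sup>2 * mix \<pi> u1 u2 f x)"
      using mix_nonneg[OF f' pi] mult_ln_squared_le[OF mix_nonneg[OF f' pi] mix_le[OF pi SLC_le_peak[OF f'] SLC_le_peak[OF f']]]
      by (intro AE_I2) (simp add: abs_of_nonneg)
  qed measurable
qed

lemma integrable_mult_of_square:
  fixes g h :: "real \<Rightarrow> real"
  assumes "integrable lborel g" "\<And>x. 0 \<le> g x" "h \<in> borel_measurable borel" "integrable lborel (\<lambda>x. g x * (h x)\<^sup>2)"
  shows "integrable lborel (\<lambda>x. g x * h x)"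
proof -
  have "integrable lborel (\<lambda>x. g x + g x * (h x)\<^sup>2)" using assms by simp
  then show ?thesis
  proof (rule Bochner_Integration.integrable_bound)
    have "\<bar>t\<bar> \<le> 1 + t\<^sup>2" for t :: real
      using zero_le_power2[of "\<bar>t\<bar> - 1/2"] by (simp add: power2_eq_square algebra_simps)
    then have "g x * \<bar>h x\<bar> \<le> g x * (1 + (h x)\<^sup>2)" for x using assms by (intro mult_left_mono) auto
    then show "AE x in lborel. norm (g x * h x) \<le> norm (g x + g x * (h x)\<^sup>2)"
      using assms by (intro AE_I2) (simp add: abs_mult algebra_simps)
    show "(\<lambda>x. g x * h x) \<in> borel_measurable lborel"
      using assms(3) borel_measurable_integrable[OF assms(1)] by simp
  qed
qed

section \<open>From likelihood to Hellinger distance\<close>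

text \<open>The squared Hellinger distance is one minus the affinity \<open>\<integral> sqrt (p g)\<close>, and \<open>ln t \<le> 2 (sqrt t - 1)\<close> at
  \<open>t = (p + \<eta>) / g\<close> bounds the expected log-likelihood ratio by the affinity. The regularization \<open>\<eta>\<close>, which
  makes the logarithm bounded below, is paid for by \<open>sqrt (p + \<eta>) \<le> sqrt p + sqrt \<eta>\<close>.\<close>
lemma hellinger_le_of_loglik:
  assumes g: "integrable lborel g" "\<And>x. 0 \<le> g x" "(\<integral>x. g x \<partial>lborel) = 1"
    and p: "integrable lborel p" "\<And>x. 0 \<le> p x" "(\<integral>x. p x \<partial>lborel) = 1"
    and sg: "integrable lborel (\<lambda>x. sqrt (g x))"
    and lg: "integrable lborel (\<lambda>x. g x * ln (g x))" and lp: "integrable lborel (\<lambda>x. g x * ln (p x + \<eta>))"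
    and eta: "0 < \<eta>"
    and le: "(\<integral>x. g x * ln (g x) \<partial>lborel) - c \<le> (\<integral>x. g x * ln (p x + \<eta>) \<partial>lborel)"
  shows "(hellinger p g)\<^sup>2 \<le> c / 2 + sqrt \<eta> * (\<integral>x. sqrt (g x) \<partial>lborel)"
proof -
  note [measurable] = borel_measurable_integrable[OF g(1)] borel_measurable_integrable[OF p(1)]
  have aff: "integrable lborel (\<lambda>x. sqrt (p x) * sqrt (g x))"
  proof (rule Bochner_Integration.integrable_bound)
    show "integrable lborel (\<lambda>x. (p x + g x) / 2)" using p g by simp
    show "AE x in lborel. norm (sqrt (p x) * sqrt (g x)) \<le> norm ((p x + g x) / 2)"
      using arith_geo_mean_sqrt p(2) g(2) by (intro AE_I2) (simp add: real_sqrt_mult)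
  qed measurable
  define A where "A = (\<integral>x. sqrt (p x) * sqrt (g x) \<partial>lborel)"
  have "(\<integral>x. (sqrt (p x) - sqrt (g x))\<^sup>2 \<partial>lborel) = (\<integral>x. p x + g x - 2 * (sqrt (p x) * sqrt (g x)) \<partial>lborel)"
    using p(2) g(2) by (intro Bochner_Integration.integral_cong) (auto simp: power2_diff)
  also have "\<dots> = 2 - 2 * A" using p g aff by (simp add: A_def)
  finally have H: "(hellinger p g)\<^sup>2 = 1 - A"
  proof -
    assume eq: "(\<integral>x. (sqrt (p x) - sqrt (g x))\<^sup>2 \<partial>lborel) = 2 - 2 * A"
    have "0 \<le> (\<integral>x. (sqrt (p x) - sqrt (g x))\<^sup>2 \<partial>lborel)" by simp
    then show ?thesis unfolding hellinger_def eq by simp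
  qed
  have pt: "g x * ln (p x + \<eta>) - g x * ln (g x)
      \<le> 2 * (sqrt (p x) * sqrt (g x)) + 2 * sqrt \<eta> * sqrt (g x) - 2 * g x" for x
  proof (cases "g x = 0")
    case False
    then have gx: "0 < g x" using g(2)[of x] by simp
    define r where "r = sqrt ((p x + \<eta>) / g x)"
    have px: "0 < p x + \<eta>" using p(2)[of x] eta by simp
    have r: "0 < r" "r\<^sup>2 = (p x + \<eta>) / g x" using gx px by (auto simp: r_def)
    have "ln (p x + \<eta>) - ln (g x) = ln (r\<^sup>2)" using gx px by (simp add: r(2) ln_div)
    also have "\<dots> = 2 * ln r" using r(1) by (simp add: ln_realpow)
    also have "\<dots> \<le> 2 * (r - 1)" using ln_le_minus_one[OF r(1)] by simp
    finally have "g x * (ln (p x + \<eta>) - ln (g x)) \<le> g x * (2 * (r - 1))"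
      using gx by (intro mult_left_mono) auto
    also have "g x * (2 * (r - 1)) = 2 * (g x * r) - 2 * g x" by (simp add: algebra_simps)
    also have "g x * r = sqrt (g x) * sqrt (p x + \<eta>)"
      using gx unfolding r_def real_sqrt_divide
      by (metis (no_types) less_imp_le mult.commute real_div_sqrt times_divide_eq_left times_divide_eq_right)
    also have "sqrt (p x + \<eta>) \<le> sqrt (p x) + sqrt \<eta>"
      using p(2) eta by (intro sqrt_add_le_add_sqrt) auto
    finally show ?thesis using gx by (simp add: algebra_simps)
  qed simp
  have "- c \<le> (\<integral>x. g x * ln (p x + \<eta>) - g x * ln (g x) \<partial>lborel)" using le lg lp by simp
  also have "\<dots> \<le> (\<integral>x. 2 * (sqrt (p x) * sqrt (g x)) + 2 * sqrt \<eta> * sqrt (g x) - 2 * g x \<partial>lborel)"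
    using pt lg lp aff sg g(1) by (intro integral_mono) auto
  also have "\<dots> = 2 * A + 2 * sqrt \<eta> * (\<integral>x. sqrt (g x) \<partial>lborel) - 2"
    using aff sg g by (simp add: A_def)
  finally show ?thesis unfolding H by simp
qed

section \<open>A bound on the peak\<close>

text \<open>Truncation gives the distance to the nearer location a second moment under every density.\<close>
definition truncated_dist :: "real \<Rightarrow> real \<Rightarrow> real \<Rightarrow> real" where
  "truncated_dist v1 v2 z = min 1 (min \<bar>z - v1\<bar> \<bar>z - v2\<bar>)"

lemma truncated_dist_bounds: "0 \<le> truncated_dist v1 v2 z" "truncated_dist v1 v2 z \<le> 1"
  by (auto simp: truncated_dist_def)

lemma truncated_dist_measurable [measurable]: "truncated_dist v1 v2 \<in> borel_measurable borel"
  unfolding truncated_dist_def[abs_def] by measurable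

lemma truncated_dist_mean_pos:
  assumes g: "integrable lborel g" "\<And>x. 0 \<le> g x" "(\<integral>x. g x \<partial>lborel) = 1"
  shows "0 < (\<integral>x. g x * truncated_dist v1 v2 x \<partial>lborel)"
proof -
  let ?T = "truncated_dist v1 v2"
  note [measurable] = borel_measurable_integrable[OF g(1)]
  have int: "integrable lborel (\<lambda>x. g x * ?T x)"
  proof (rule Bochner_Integration.integrable_bound[OF g(1)])
    show "AE x in lborel. norm (g x * ?T x) \<le> norm (g x)"
      using g(2) truncated_dist_bounds by (intro AE_I2) (simp add: abs_mult mult_left_le)
  qed measurable
  have nn: "0 \<le> (\<integral>x. g x * ?T x \<partial>lborel)"
    using g(2) truncated_dist_bounds by (intro integral_nonneg_AE) auto
  have "(\<integral>x. g x * ?T x \<partial>lborel) \<noteq> 0"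
  proof
    assume "(\<integral>x. g x * ?T x \<partial>lborel) = 0"
    then have "AE x in lborel. g x * ?T x = 0"
      using integral_nonneg_eq_0_iff_AE[OF int] g(2) truncated_dist_bounds by auto
    moreover have "AE x in lborel. x \<noteq> v1" "AE x in lborel. x \<noteq> v2"
      by (rule AE_lborel_singleton)+
    ultimately have "AE x in lborel. g x = 0"
      by eventually_elim (auto simp: truncated_dist_def min_def split: if_splits)
    then have "(\<integral>x. g x \<partial>lborel) = (\<integral>x. 0 \<partial>(lborel :: real measure))"
      by (intro integral_cong_AE) auto
    then show False using g(3) by simp
  qed
  with nn show ?thesis by simp
qed

text \<open>Since a density with peak \<open>M\<close> decays like \<open>exp (- ln 2 * M * \<bar>x\<bar>)\<close>, observations at a positive average distance from
  both locations make the log-likelihood at most \<open>ln (2 M) - c M\<close>: high spikes at the locations do not pay.\<close>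
lemma loglik_le_of_peak:
  assumes f: "f \<in> SLC1" and pi: "0 \<le> \<pi>" "\<pi> \<le> 1" and n: "0 < n"
    and pos: "\<And>i. i < n \<Longrightarrow> 0 < mix \<pi> u1 u2 f (x i)"
    and d: "\<bar>u1 - v1\<bar> \<le> d" "\<bar>u2 - v2\<bar> \<le> d"
  shows "empirical_mean n x (\<lambda>z. ln (mix \<pi> u1 u2 f z))
      \<le> ln (2 * f 0) - ln 2 * f 0 * (empirical_mean n x (truncated_dist v1 v2) - d)"
proof -
  have M: "0 < f 0" using f by (simp add: SLC_peak_pos SLC1_def)
  let ?T = "truncated_dist v1 v2"
  let ?b = "\<lambda>z. 2 * f 0 * exp (- ln 2 * f 0 * (?T z - d))"
  have comp: "f (z - u) \<le> ?b z" if "\<bar>u - v\<bar> \<le> d" "?T z \<le> \<bar>z - v\<bar>" for u v z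
  proof -
    have "?T z - d \<le> \<bar>z - u\<bar>" using that by linarith
    then have "ln 2 * f 0 * (?T z - d) \<le> ln 2 * f 0 * \<bar>z - u\<bar>" using M by (intro mult_left_mono) auto
    then have "2 * f 0 * exp (- ln 2 * f 0 * \<bar>z - u\<bar>) \<le> ?b z" using M by simp
    then show ?thesis using SLC1_exp_decay[OF f, of "z - u"] by linarith
  qed
  have mix_bd: "mix \<pi> u1 u2 f z \<le> ?b z" for z
    by (rule mix_le[OF pi comp[OF d(1)] comp[OF d(2)]]) (auto simp: truncated_dist_def)
  have "empirical_mean n x (\<lambda>z. ln (mix \<pi> u1 u2 f z))
      \<le> empirical_mean n x (\<lambda>z. (ln (2 * f 0) + ln 2 * f 0 * d) + (- (ln 2 * f 0)) * ?T z)"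
  proof (rule empirical_mean_mono)
    fix i assume i: "i < n"
    have "ln (mix \<pi> u1 u2 f (x i)) \<le> ln (?b (x i))" by (rule ln_mono[OF mix_bd pos[OF i]])
    also have "\<dots> = ln (2 * f 0) + (- ln 2 * f 0 * (?T (x i) - d))" using M by (subst ln_mult_pos) auto
    finally show "ln (mix \<pi> u1 u2 f (x i)) \<le> (ln (2 * f 0) + ln 2 * f 0 * d) + (- (ln 2 * f 0)) * ?T (x i)"
      by (simp add: algebra_simps)
  qed
  also have "\<dots> = ln (2 * f 0) - ln 2 * f 0 * (empirical_mean n x ?T - d)"
    unfolding empirical_mean_add empirical_mean_cmult empirical_mean_const[OF n] by (simp add: algebra_simps)
  finally show ?thesis .
qed

lemma ln_minus_linear_bounded_superlevel:
  fixes c L :: real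
  assumes c: "0 < c"
  obtains M0 where "0 < M0" "\<And>M. 0 < M \<Longrightarrow> L \<le> ln (2 * M) - c * M \<Longrightarrow> M \<le> M0"
proof
  let ?M0 = "max 1 (2 * (ln (4 / c) - L) / c)"
  show "0 < ?M0" by simp
  fix M :: real assume M: "0 < M" "L \<le> ln (2 * M) - c * M"
  have "ln (2 * M) = ln ((c * M / 2) * (4 / c))" using c by simp
  also have "\<dots> = ln (c * M / 2) + ln (4 / c)" using c M by (intro ln_mult_pos) auto
  also have "\<dots> \<le> c * M / 2 + ln (4 / c)" using ln_le_minus_one[of "c * M / 2"] c M by simp
  finally have "M * c \<le> 2 * (ln (4 / c) - L)" using M by (simp add: algebra_simps)
  then have "M \<le> 2 * (ln (4 / c) - L) / c" using c by (simp add: pos_le_divide_eq)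
  then show "M \<le> ?M0" by simp
qed

section \<open>A uniform law of large numbers\<close>

lemma abs_ln_add_le:
  fixes y C \<eta> :: real
  assumes "0 \<le> y" "y \<le> C" "0 < \<eta>"
  shows "\<bar>ln (y + \<eta>)\<bar> \<le> \<bar>ln \<eta>\<bar> + \<bar>ln (C + \<eta>)\<bar>"
proof -
  have "ln \<eta> \<le> ln (y + \<eta>)" "ln (y + \<eta>) \<le> ln (C + \<eta>)"
    using assms by (auto intro!: ln_mono)
  then show ?thesis by linarith
qed

lemma abs_ln_add_diff_le:
  fixes y z \<eta> :: real
  assumes "0 \<le> y" "0 \<le> z" "0 < \<eta>"
  shows "\<bar>ln (y + \<eta>) - ln (z + \<eta>)\<bar> \<le> \<bar>y - z\<bar> / \<eta>"
proof -
  have *: "ln (b + \<eta>) - ln (a + \<eta>) \<le> (b - a) / \<eta>" if "0 \<le> a" "a \<le> b" for a b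
  proof -
    have "ln (b + \<eta>) - ln (a + \<eta>) = ln ((b + \<eta>) / (a + \<eta>))" using that assms by (simp add: ln_div)
    also have "\<dots> \<le> (b + \<eta>) / (a + \<eta>) - 1" using that assms by (intro ln_le_minus_one) auto
    also have "\<dots> = (b - a) / (a + \<eta>)" using that assms by (simp add: field_simps)
    also have "\<dots> \<le> (b - a) / \<eta>" using that assms by (intro divide_left_mono) auto
    finally show ?thesis .
  qed
  have mono: "ln (a + \<eta>) \<le> ln (b + \<eta>)" if "0 \<le> a" "a \<le> b" for a b
    using that assms by (intro ln_mono) auto
  show ?thesis
  proof (cases "y \<le> z")
    case True
    then show ?thesis using *[of y z] mono[of y z] assms by simp
  next
    case False
    then show ?thesis using *[of z y] mono[of z y] assms by simp
  qed
qed

text \<open>Each of the two unimodal components has total variation at most \<open>2 M\<close>, and \<open>y \<mapsto> ln (y + \<eta>)\<close> is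
  \<open>1/\<eta>\<close>-Lipschitz on the nonnegative numbers.\<close>
lemma cell_variation_ln_mix:
  assumes f: "f \<in> SLC" "f 0 \<le> M" and pi: "0 \<le> \<pi>" "\<pi> \<le> 1" and q: "mono q" and eta: "0 < \<eta>"
  shows "cell_variation_le q N (\<lambda>z. ln (mix \<pi> u1 u2 f z + \<eta>)) (2 * M / \<eta>)"
proof -
  have "cell_variation_le q N (\<lambda>z. ln (mix \<pi> u1 u2 f z + \<eta>)) (\<pi> / \<eta> * (2 * f 0) + (1 - \<pi>) / \<eta> * (2 * f 0))"
  proof (rule cell_variation_dominated[OF cell_variation_SLC_shift[OF f(1) q] cell_variation_SLC_shift[OF f(1) q]])
    fix x y
    let ?m = "mix \<pi> u1 u2 f"
    have "\<bar>?m x - ?m y\<bar> = \<bar>\<pi> * (f (x - u1) - f (y - u1)) + (1 - \<pi>) * (f (x - u2) - f (y - u2))\<bar>"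
      by (simp add: mix_def algebra_simps)
    also have "\<dots> \<le> \<pi> * \<bar>f (x - u1) - f (y - u1)\<bar> + (1 - \<pi>) * \<bar>f (x - u2) - f (y - u2)\<bar>"
      using pi by (intro order_trans[OF abs_triangle_ineq]) (simp add: abs_mult)
    finally have "\<bar>?m x - ?m y\<bar> / \<eta> \<le> (\<pi> * \<bar>f (x - u1) - f (y - u1)\<bar> + (1 - \<pi>) * \<bar>f (x - u2) - f (y - u2)\<bar>) / \<eta>"
      using eta by (intro divide_right_mono) auto
    with abs_ln_add_diff_le[OF mix_nonneg[OF f(1) pi] mix_nonneg[OF f(1) pi] eta, of u1 u2 x u1 u2 y]
    show "\<bar>ln (?m x + \<eta>) - ln (?m y + \<eta>)\<bar>
        \<le> \<pi> / \<eta> * \<bar>f (x - u1) - f (y - u1)\<bar> + (1 - \<pi>) / \<eta> * \<bar>f (x - u2) - f (y - u2)\<bar>"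
      by (simp add: add_divide_distrib)
  qed (use pi eta in auto)
  also have "\<pi> / \<eta> * (2 * f 0) + (1 - \<pi>) / \<eta> * (2 * f 0) = 2 * f 0 / \<eta>"
    using eta by (simp add: field_simps)
  finally show ?thesis
    using f(2) eta unfolding cell_variation_le_def
    by (smt (verit) divide_right_mono)
qed

text \<open>A one-sided uniform law of large numbers over all mixtures with peak at most \<open>M\<close>, reduced to finitely many ordinary laws
  of large numbers: the set \<open>H\<close> consists of the indicators of the cells and depends on the class only through \<open>M\<close> and
  \<open>\<eta>\<close>. The parameters \<open>\<pi>\<close>, \<open>u1\<close>, \<open>u2\<close> and \<open>f\<close> may depend on the sample.\<close>
lemma loglik_uniform_upper_bound:
  assumes g: "integrable lborel g" "\<And>x. 0 \<le> g x" "\<And>x. g x \<le> G"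
    and eta: "0 < \<eta>" and M: "0 < M" and k: "0 < k"
  obtains e and H :: "(real \<Rightarrow> real) set" where "0 < e" "finite H"
    "\<And>h. h \<in> H \<Longrightarrow> h \<in> borel_measurable borel \<and> (\<forall>x. h x \<in> {0..1})"
    "\<And>n x \<pi> u1 u2 f. f \<in> SLC \<Longrightarrow> f 0 \<le> M \<Longrightarrow> 0 \<le> \<pi> \<Longrightarrow> \<pi> \<le> 1 \<Longrightarrow>
      (\<And>h. h \<in> H \<Longrightarrow> \<bar>empirical_mean n x h - (\<integral>z. g z * h z \<partial>lborel)\<bar> \<le> e) \<Longrightarrow>
      empirical_mean n x (\<lambda>z. ln (mix \<pi> u1 u2 f z + \<eta>))
        \<le> (\<integral>z. g z * ln (mix \<pi> u1 u2 f z + \<eta>) \<partial>lborel) + k"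
proof -
  define V where "V = 2 * M / \<eta>"
  define B where "B = \<bar>ln \<eta>\<bar> + \<bar>ln (M + \<eta>)\<bar>"
  define p where "p = k / (6 * V)"
  have V: "0 < V" using M eta by (simp add: V_def)
  have p: "0 < p" "3 * p * V = k / 2" using V k by (auto simp: p_def)
  have B: "0 \<le> B" by (simp add: B_def)
  obtain q :: "real \<Rightarrow> nat" and N where q: "mono q" "\<And>x. q x \<le> N" "\<And>k. {x. q x = k} \<in> sets borel"
    "\<And>k. (\<integral>x. g x * indicator {x. q x = k} x \<partial>lborel) \<le> p"
    using small_cells_exist[OF g p(1)] by blast
  define e where "e = min p (k / (2 * (real N + 1) * (B + 1)))"
  have e: "0 < e" "e \<le> p" using p(1) k B by (auto simp: e_def)
  have eB: "(real N + 1) * e * B \<le> k / 2"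
  proof -
    have "e \<le> k / (2 * (real N + 1) * (B + 1))" by (simp add: e_def)
    then have "e * (2 * (real N + 1) * (B + 1)) \<le> k"
      using B by (simp add: pos_le_divide_eq)
    moreover have "(real N + 1) * e * B \<le> (real N + 1) * e * (B + 1)"
      using e(1) by (intro mult_left_mono) auto
    ultimately show ?thesis by (simp add: algebra_simps)
  qed
  let ?I = "\<lambda>k. indicator {x. q x = k} :: real \<Rightarrow> real"
  show thesis
  proof (rule that[of e "?I ` {..N}"])
    show "h \<in> borel_measurable borel \<and> (\<forall>x. h x \<in> {0..1})" if "h \<in> ?I ` {..N}" for h
      using that q(3) by (auto intro: borel_measurable_indicator simp: indicator_def)
    fix n x and \<pi> u1 u2 :: real and f
    assume f: "f \<in> SLC" "f 0 \<le> M" and pi: "0 \<le> \<pi>" "\<pi> \<le> 1"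
      and freq: "\<And>h. h \<in> ?I ` {..N} \<Longrightarrow> \<bar>empirical_mean n x h - (\<integral>z. g z * h z \<partial>lborel)\<bar> \<le> e"
    note [measurable] = SLC_borel_measurable[OF f(1)]
    let ?h = "\<lambda>z. ln (mix \<pi> u1 u2 f z + \<eta>)"
    have "empirical_mean n x ?h \<le> (\<integral>z. g z * ?h z \<partial>lborel) + (real N + 1) * e * B + 3 * p * V"
    proof (rule empirical_mean_le_integral_cells[OF g(1,2) q(3,2) q(4) _ e(2)])
      show "cell_variation_le q N ?h V"
        unfolding V_def by (rule cell_variation_ln_mix[OF f pi q(1) eta])
      show "\<bar>?h z\<bar> \<le> B" for z
        unfolding B_def using mix_nonneg[OF f(1) pi] order_trans[OF SLC_le_peak[OF f(1)] f(2)] eta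
        by (intro abs_ln_add_le mix_le pi) auto
    qed (use freq in auto)
    then show "empirical_mean n x ?h \<le> (\<integral>z. g z * ?h z \<partial>lborel) + k" using eB p(2) by linarith
  qed (use e in auto)
qed

section \<open>Samples on which the estimator is close\<close>

text \<open>Three kinds of empirical means control the maximizer: that of \<open>ln g0\<close> (lower bound on the maximum), that of the
  truncated distance (bound on the peak) and those of the cell indicators (uniform law of large numbers). The order of
  choice matters: \<open>\<eta>\<close> and the peak bound \<open>M0\<close> come first, they determine the cells and hence \<open>H\<close>, and the tolerance
  \<open>\<kappa>\<close> comes last. No randomness is involved, so the estimates and the maximizer may depend on the sample in any way.\<close>
lemma hellinger_MLE_le:
  fixes f0 :: "real \<Rightarrow> real" and \<pi>0 v1 v2 \<epsilon> :: real
  assumes f0: "f0 \<in> SLC1" and pi0: "0 < \<pi>0" "\<pi>0 < 1" and eps: "0 < \<epsilon>"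
    and g0: "g0 = mix \<pi>0 v1 v2 f0"
  obtains \<kappa> and H :: "(real \<Rightarrow> real) set" where "0 < \<kappa>" "finite H"
    "\<And>h. h \<in> H \<Longrightarrow> h \<in> borel_measurable borel \<and> integrable lborel (\<lambda>x. g0 x * (h x)\<^sup>2)"
    "\<And>n x \<pi> u1 u2 \<psi>. 0 < n \<Longrightarrow> is_MLE n x \<pi> u1 u2 \<psi> \<Longrightarrow> (\<And>i. i < n \<Longrightarrow> 0 < g0 (x i)) \<Longrightarrow>
      \<bar>\<pi> - \<pi>0\<bar> \<le> \<kappa> \<Longrightarrow> \<bar>u1 - v1\<bar> \<le> \<kappa> \<Longrightarrow> \<bar>u2 - v2\<bar> \<le> \<kappa> \<Longrightarrow>
      (\<And>h. h \<in> H \<Longrightarrow> \<bar>empirical_mean n x h - (\<integral>z. g0 z * h z \<partial>lborel)\<bar> \<le> \<kappa>) \<Longrightarrow>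
      hellinger (mix \<pi> u1 u2 (\<lambda>z. exp_ereal (\<psi> z))) g0 \<le> \<epsilon>"
proof -
  have f0': "f0 \<in> SLC" using f0 by (simp add: SLC1_def)
  have pi0': "0 \<le> \<pi>0" "\<pi>0 \<le> 1" using pi0 by auto
  note [measurable] = SLC_borel_measurable[OF f0']
  have g0_meas[measurable]: "g0 \<in> borel_measurable borel" unfolding g0 by measurable
  have g: "integrable lborel g0" "\<And>x. 0 \<le> g0 x" "(\<integral>x. g0 x \<partial>lborel) = 1" "\<And>x. g0 x \<le> f0 0"
    unfolding g0 using mix_integral[OF f0] mix_nonneg[OF f0' pi0'] mix_le[OF pi0'] SLC_le_peak[OF f0'] by auto
  have sg: "integrable lborel (\<lambda>x. sqrt (g0 x))"
    unfolding g0 by (rule mix_integrable_sqrt[OF f0 pi0'])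
  have lg2: "integrable lborel (\<lambda>x. g0 x * (ln (g0 x))\<^sup>2)"
    unfolding g0 by (rule mix_integrable_ln_squared[OF f0 pi0'])
  have lg: "integrable lborel (\<lambda>x. g0 x * ln (g0 x))"
    by (rule integrable_mult_of_square[OF g(1,2) _ lg2]) measurable
  define L where "L = (\<integral>x. g0 x * ln (g0 x) \<partial>lborel)"
  define S where "S = (\<integral>x. sqrt (g0 x) \<partial>lborel)"
  define m where "m = (\<integral>x. g0 x * truncated_dist v1 v2 x \<partial>lborel)"
  \<comment> \<open>The final bound on the squared distance is \<open>5 * k / 2 + sqrt \<eta> * S\<close>; each summand receives \<open>\<epsilon>\<^sup>2 / 2\<close>.
    The bound \<open>k \<le> 1/2\<close> lets the peak bound below be chosen independently of \<open>k\<close>.\<close>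
  define k where "k = min (1/2) (\<epsilon>\<^sup>2 / 5)"
  define \<eta> where "\<eta> = (\<epsilon>\<^sup>2 / (2 * (S + 1)))\<^sup>2"
  have m: "0 < m" unfolding m_def by (rule truncated_dist_mean_pos[OF g(1-3)])
  have S: "0 \<le> S" unfolding S_def using g(2) by (intro integral_nonneg_AE) auto
  have k: "0 < k" "k \<le> 1/2" "5 * k \<le> \<epsilon>\<^sup>2" using eps by (auto simp: k_def)
  have eta: "0 < \<eta>" "sqrt \<eta> * S \<le> \<epsilon>\<^sup>2 / 2"
  proof -
    show "0 < \<eta>" using eps S by (simp add: \<eta>_def)
    have "sqrt \<eta> = \<epsilon>\<^sup>2 / (2 * (S + 1))" using S by (simp add: \<eta>_def)
    then have "sqrt \<eta> * S = (\<epsilon>\<^sup>2 / 2) * (S / (S + 1))" by simp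
    also have "\<dots> \<le> (\<epsilon>\<^sup>2 / 2) * 1" using S by (intro mult_left_mono) auto
    finally show "sqrt \<eta> * S \<le> \<epsilon>\<^sup>2 / 2" by simp
  qed
  obtain M0 where M0: "0 < M0" "\<And>M. 0 < M \<Longrightarrow> L - 2 \<le> ln (2 * M) - (ln 2 * m / 2) * M \<Longrightarrow> M \<le> M0"
    using ln_minus_linear_bounded_superlevel[of "ln 2 * m / 2" "L - 2"] m by auto
  obtain e H where e: "0 < e" "finite H"
    "\<And>h. h \<in> H \<Longrightarrow> h \<in> borel_measurable borel \<and> (\<forall>x. h x \<in> {0..1})"
    "\<And>n x \<pi> u1 u2 f. f \<in> SLC \<Longrightarrow> f 0 \<le> M0 \<Longrightarrow> 0 \<le> \<pi> \<Longrightarrow> \<pi> \<le> 1 \<Longrightarrow>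
      (\<And>h. h \<in> H \<Longrightarrow> \<bar>empirical_mean n x h - (\<integral>z. g0 z * h z \<partial>lborel)\<bar> \<le> e) \<Longrightarrow>
      empirical_mean n x (\<lambda>z. ln (mix \<pi> u1 u2 f z + \<eta>))
        \<le> (\<integral>z. g0 z * ln (mix \<pi> u1 u2 f z + \<eta>) \<partial>lborel) + k"
    using loglik_uniform_upper_bound[OF g(1,2,4) eta(1) M0(1) k(1)] by blast
  define \<kappa> where "\<kappa> = Min {k, k / (2 * f0 0), k * \<pi>0, k * (1 - \<pi>0), m / 4, e}"
  have peak0: "0 < f0 0" by (rule SLC_peak_pos[OF f0'])
  have \<kappa>: "0 < \<kappa>" "\<kappa> \<le> k" "\<kappa> \<le> k / (2 * f0 0)" "\<kappa> \<le> k * \<pi>0" "\<kappa> \<le> k * (1 - \<pi>0)" "\<kappa> \<le> m / 4" "\<kappa> \<le> e"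
    using k m e peak0 pi0 by (auto simp: \<kappa>_def)
  have \<kappa>_peak: "2 * \<kappa> * f0 0 \<le> k" using \<kappa>(3) peak0 by (simp add: pos_le_divide_eq ac_simps)
  let ?H = "insert (\<lambda>x. ln (g0 x)) (insert (truncated_dist v1 v2) H)"
  show thesis
  proof (rule that[of \<kappa> ?H])
    fix h assume "h \<in> ?H"
    moreover have "integrable lborel (\<lambda>x. g0 x * (h x)\<^sup>2)"
      if [measurable]: "h \<in> borel_measurable borel" and h: "\<And>x. h x \<in> {0..1}" for h
    proof (rule Bochner_Integration.integrable_bound[OF g(1)])
      have "(h x)\<^sup>2 \<le> 1" for x using h[of x] by (intro power_le_one) auto
      then show "AE x in lborel. norm (g0 x * (h x)\<^sup>2) \<le> norm (g0 x)"
        using g(2) by (intro AE_I2) (simp add: abs_mult mult_left_le)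
    qed measurable
    ultimately show "h \<in> borel_measurable borel \<and> integrable lborel (\<lambda>x. g0 x * (h x)\<^sup>2)"
      using lg2 e(3) truncated_dist_bounds by auto
  next
    fix n x and \<pi> u1 u2 :: real and \<psi>
    assume n: "0 < n" and mle: "is_MLE n x \<pi> u1 u2 \<psi>" and pos: "\<And>i. i < n \<Longrightarrow> 0 < g0 (x i)"
      and pi: "\<bar>\<pi> - \<pi>0\<bar> \<le> \<kappa>" and u: "\<bar>u1 - v1\<bar> \<le> \<kappa>" "\<bar>u2 - v2\<bar> \<le> \<kappa>"
      and freq: "\<And>h. h \<in> ?H \<Longrightarrow> \<bar>empirical_mean n x h - (\<integral>z. g0 z * h z \<partial>lborel)\<bar> \<le> \<kappa>"
    define f where "f = (\<lambda>z. exp_ereal (\<psi> z))"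
    define p where "p = mix \<pi> u1 u2 f"
    have pik: "(1 - k) * \<pi>0 \<le> \<pi>" "(1 - k) * (1 - \<pi>0) \<le> 1 - \<pi>"
      using pi \<kappa>(4,5) by (auto simp: algebra_simps abs_le_iff)
    have "0 \<le> (1 - k) * \<pi>0" "0 \<le> (1 - k) * (1 - \<pi>0)" using k pi0 by auto
    then have pi': "0 \<le> \<pi>" "\<pi> \<le> 1" using pik by linarith+
    have k1: "k < 1" using k by simp
    note mle' = MLE_loglik_lower_bound[OF mle f_def n f0 pi0' _ u k1 pik]
    have f: "f \<in> SLC1" by (rule mle'(1)) (rule pos[unfolded g0])
    then have f': "f \<in> SLC" by (simp add: SLC1_def)
    note [measurable] = SLC_borel_measurable[OF f']
    have p_meas[measurable]: "p \<in> borel_measurable borel" unfolding p_def by measurable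
    have p_pos: "0 < p (x i)" if "i < n" for i unfolding p_def
      by (rule mle'(2)[OF _ that]) (rule pos[unfolded g0])
    have p: "integrable lborel p" "\<And>x. 0 \<le> p x" "(\<integral>x. p x \<partial>lborel) = 1"
      unfolding p_def using mix_integral[OF f] mix_nonneg[OF f' pi'] by auto
    have "k * k \<le> 1/2 * k" using k by (intro mult_right_mono) auto
    then have "- 2 * k \<le> ln (1 - k)"
      using ln_one_minus_pos_lower_bound[of k] k(1,2) unfolding power2_eq_square by linarith
    moreover have "L - k \<le> empirical_mean n x (\<lambda>z. ln (g0 z))" using freq[of "\<lambda>z. ln (g0 z)"] \<kappa>(2) by (auto simp: L_def)
    moreover have "empirical_mean n x (\<lambda>z. ln (g0 z)) + ln (1 - k) - 2 * \<kappa> * f0 0 \<le> empirical_mean n x (\<lambda>z. ln (p z))"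
      unfolding p_def g0 by (rule mle'(3)) (rule pos[unfolded g0])
    ultimately have lower: "L - 4 * k \<le> empirical_mean n x (\<lambda>z. ln (p z))" using \<kappa>_peak by linarith
    have peak: "0 < f 0" by (rule SLC_peak_pos[OF f'])
    have "m - \<kappa> \<le> empirical_mean n x (truncated_dist v1 v2)"
      using freq[of "truncated_dist v1 v2"] by (auto simp: m_def)
    then have "m / 2 \<le> empirical_mean n x (truncated_dist v1 v2) - \<kappa>" using \<kappa>(6) by linarith
    then have "ln 2 * f 0 * (m / 2) \<le> ln 2 * f 0 * (empirical_mean n x (truncated_dist v1 v2) - \<kappa>)"
      using peak by (intro mult_left_mono) auto
    moreover have "empirical_mean n x (\<lambda>z. ln (p z)) \<le> ln (2 * f 0) - ln 2 * f 0 * (empirical_mean n x (truncated_dist v1 v2) - \<kappa>)"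
      unfolding p_def using p_pos[unfolded p_def] by (intro loglik_le_of_peak[OF f pi' n _ u])
    ultimately have "L - 2 \<le> ln (2 * f 0) - (ln 2 * m / 2) * f 0" using lower k by (simp add: ac_simps)
    then have "f 0 \<le> M0" by (rule M0(2)[OF peak])
    have "L - 4 * k \<le> empirical_mean n x (\<lambda>z. ln (p z + \<eta>))"
      using p_pos eta(1) by (intro order_trans[OF lower empirical_mean_mono] ln_mono) auto
    also have "\<dots> \<le> (\<integral>z. g0 z * ln (p z + \<eta>) \<partial>lborel) + k"
      unfolding p_def
    proof (rule e(4)[OF f' \<open>f 0 \<le> M0\<close> pi'])
      show "\<bar>empirical_mean n x h - (\<integral>z. g0 z * h z \<partial>lborel)\<bar> \<le> e" if "h \<in> H" for h
        using freq[of h] that \<kappa>(7) by auto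
    qed
    finally have upper: "L - 5 * k \<le> (\<integral>z. g0 z * ln (p z + \<eta>) \<partial>lborel)" by simp
    have lp: "integrable lborel (\<lambda>z. g0 z * ln (p z + \<eta>))"
    proof (rule Bochner_Integration.integrable_bound)
      let ?B = "\<bar>ln \<eta>\<bar> + \<bar>ln (M0 + \<eta>)\<bar>"
      show "integrable lborel (\<lambda>z. g0 z * ?B)" using g(1) by simp
      have "p z \<le> M0" for z
        unfolding p_def using SLC_le_peak[OF f'] \<open>f 0 \<le> M0\<close> by (intro mix_le pi') (auto intro: order_trans)
      then have "\<bar>ln (p z + \<eta>)\<bar> \<le> ?B" for z using p(2) eta(1) by (intro abs_ln_add_le) auto
      then show "AE z in lborel. norm (g0 z * ln (p z + \<eta>)) \<le> norm (g0 z * ?B)"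
        using g(2) by (intro AE_I2) (auto simp: abs_mult intro!: mult_left_mono)
    qed measurable
    have "(hellinger p g0)\<^sup>2 \<le> 5 * k / 2 + sqrt \<eta> * S"
      unfolding S_def using upper[unfolded L_def]
      by (intro hellinger_le_of_loglik[OF g(1-3) p sg lg lp eta(1)])
    also have "\<dots> \<le> \<epsilon>\<^sup>2" using k(3) eta(2) by linarith
    finally have "hellinger p g0 \<le> \<epsilon>" by (rule power2_le_imp_le[OF _ less_imp_le[OF eps]])
    then show "hellinger (mix \<pi> u1 u2 (\<lambda>z. exp_ereal (\<psi> z))) g0 \<le> \<epsilon>"
      by (simp add: p_def f_def)
  qed (use \<kappa> e in auto)
qed

section \<open>Events of probability tending to one\<close>

text \<open>With high probability. Outer measure admits events defined by a maximum likelihood estimator, which need not be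
  measurable.\<close>
definition whp :: "'w measure \<Rightarrow> (nat \<Rightarrow> 'w \<Rightarrow> bool) \<Rightarrow> bool" where
  "whp M A \<longleftrightarrow> (\<lambda>n. outer_measure_of M {w \<in> space M. \<not> A n w}) \<longlonglongrightarrow> 0"

lemma tendsto_in_prob_iff_whp:
  "tendsto_in_prob M Z c \<longleftrightarrow> (\<forall>\<epsilon>>0. whp M (\<lambda>n w. \<bar>Z n w - c\<bar> \<le> \<epsilon>))"
  by (simp add: tendsto_in_prob_def whp_def not_le)

lemma outer_measure_of_Un_le:
  assumes "A \<subseteq> space M" "B \<subseteq> space M"
  shows "outer_measure_of M (A \<union> B) \<le> outer_measure_of M A + outer_measure_of M B"
proof -
  obtain C D where C: "C \<in> sets M" "A \<subseteq> C" "outer_measure_of M A = emeasure M C"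
    and D: "D \<in> sets M" "B \<subseteq> D" "outer_measure_of M B = emeasure M D"
    using outer_measure_of_attain[OF assms(1)] outer_measure_of_attain[OF assms(2)] by blast
  have "outer_measure_of M (A \<union> B) \<le> outer_measure_of M (C \<union> D)"
    using C D by (intro outer_measure_of_mono) auto
  also have "\<dots> = emeasure M (C \<union> D)" using C D by simp
  also have "\<dots> \<le> emeasure M C + emeasure M D" using C D by (intro emeasure_subadditive)
  finally show ?thesis using C D by simp
qed

lemma whp_mono:
  assumes "whp M A" "\<forall>\<^sub>F n in sequentially. \<forall>w\<in>space M. A n w \<longrightarrow> B n w"
  shows "whp M B"
  unfolding whp_def
proof (rule tendsto_sandwich[OF _ _ tendsto_const assms(1)[unfolded whp_def]])
  show "\<forall>\<^sub>F n in sequentially. outer_measure_of M {w \<in> space M. \<not> B n w}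
      \<le> outer_measure_of M {w \<in> space M. \<not> A n w}"
    using assms(2) by eventually_elim (auto intro!: outer_measure_of_mono)
qed simp

lemma whp_conj:
  assumes "whp M A" "whp M B"
  shows "whp M (\<lambda>n w. A n w \<and> B n w)"
  unfolding whp_def
proof (rule tendsto_sandwich[OF _ _ tendsto_const])
  show "(\<lambda>n. outer_measure_of M {w \<in> space M. \<not> A n w} + outer_measure_of M {w \<in> space M. \<not> B n w}) \<longlonglongrightarrow> 0"
    using tendsto_add[OF assms[unfolded whp_def]] by simp
  have "{w \<in> space M. \<not> (A n w \<and> B n w)} = {w \<in> space M. \<not> A n w} \<union> {w \<in> space M. \<not> B n w}" for n by auto
  then show "\<forall>\<^sub>F n in sequentially. outer_measure_of M {w \<in> space M. \<not> (A n w \<and> B n w)}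
      \<le> outer_measure_of M {w \<in> space M. \<not> A n w} + outer_measure_of M {w \<in> space M. \<not> B n w}"
    by (auto intro!: always_eventually outer_measure_of_Un_le)
qed simp

lemma whp_AE:
  assumes "\<forall>\<^sub>F n in sequentially. AE w in M. A n w"
  shows "whp M A"
  unfolding whp_def
proof (rule tendsto_eventually)
  show "\<forall>\<^sub>F n in sequentially. outer_measure_of M {w \<in> space M. \<not> A n w} = 0"
    using assms
  proof eventually_elim
    case (elim n)
    then obtain N where N: "N \<in> sets M" "emeasure M N = 0" "{w \<in> space M. \<not> A n w} \<subseteq> N"
      by (auto elim!: AE_E)
    then have "outer_measure_of M {w \<in> space M. \<not> A n w} \<le> 0"
      using outer_measure_of_mono[OF N(3), of M] by simp
    then show ?case by simp
  qed
qed

lemma whp_finite_ball: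
  assumes "finite H" "\<And>h. h \<in> H \<Longrightarrow> whp M (A h)"
  shows "whp M (\<lambda>n w. \<forall>h\<in>H. A h n w)"
  using assms
proof induction
  case empty
  show ?case by (intro whp_AE) simp
next
  case (insert h H)
  then have "whp M (\<lambda>n w. A h n w \<and> (\<forall>h\<in>H. A h n w))" by (intro whp_conj) auto
  then show ?case by simp
qed

lemma (in prob_space) sum_square_expectation:
  fixes Y :: "nat \<Rightarrow> 'a \<Rightarrow> real"
  assumes indep: "indep_vars (\<lambda>_. borel) Y UNIV"
    and int: "\<And>i. integrable M (Y i)" "\<And>i. integrable M (\<lambda>w. (Y i w)\<^sup>2)"
    and mean: "\<And>i. expectation (Y i) = 0" and var: "\<And>i. expectation (\<lambda>w. (Y i w)\<^sup>2) = v"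
  shows "integrable M (\<lambda>w. (\<Sum>i<n. Y i w)\<^sup>2)" "expectation (\<lambda>w. (\<Sum>i<n. Y i w)\<^sup>2) = real n * v"
proof -
  have pair: "integrable M (\<lambda>w. Y i w * Y j w) \<and> expectation (\<lambda>w. Y i w * Y j w) = (if i = j then v else 0)" for i j
  proof (cases "i = j")
    case True
    then show ?thesis using int(2)[of i] var[of i] by (simp add: power2_eq_square)
  next
    case False
    have "indep_vars (\<lambda>_. borel) Y {i, j}" using indep by (rule indep_vars_subset) simp
    from indep_vars_lebesgue_integral[OF _ this] indep_vars_integrable[OF _ this] False
    show ?thesis using int(1) mean by simp
  qed
  have sq: "(\<Sum>i<n. Y i w)\<^sup>2 = (\<Sum>i<n. \<Sum>j<n. Y i w * Y j w)" for w
    by (simp add: power2_eq_square sum_product)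
  show "integrable M (\<lambda>w. (\<Sum>i<n. Y i w)\<^sup>2)" unfolding sq using pair by auto
  have "expectation (\<lambda>w. \<Sum>i<n. \<Sum>j<n. Y i w * Y j w) = (\<Sum>i<n. \<Sum>j<n. expectation (\<lambda>w. Y i w * Y j w))"
    using pair by simp
  also have "\<dots> = (\<Sum>i<n. \<Sum>j<n. if i = j then v else 0)" using pair by simp
  also have "\<dots> = real n * v" by simp
  finally show "expectation (\<lambda>w. (\<Sum>i<n. Y i w)\<^sup>2) = real n * v" unfolding sq .
qed

text \<open>Chebyshev's argument: the centred sum has second moment \<open>n v\<close>, against \<open>(n \<epsilon>)\<^sup>2\<close>.\<close>
lemma (in prob_space) weak_law_of_large_numbers:
  fixes X :: "nat \<Rightarrow> 'a \<Rightarrow> real"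
  assumes indep: "indep_vars (\<lambda>_. borel) X UNIV"
    and X: "\<And>i. distributed M lborel (X i) (\<lambda>x. ennreal (g x))"
    and g: "integrable lborel g" "\<And>x. 0 \<le> g x"
    and h: "h \<in> borel_measurable borel" "integrable lborel (\<lambda>x. g x * (h x)\<^sup>2)"
    and eps: "0 < \<epsilon>"
  shows "whp M (\<lambda>n w. \<bar>empirical_mean n (\<lambda>i. X i w) h - (\<integral>x. g x * h x \<partial>lborel)\<bar> \<le> \<epsilon>)"
proof -
  note [measurable] = h(1)
  have [measurable]: "X i \<in> borel_measurable M" for i using distributed_measurable[OF X[of i]] by simp
  define \<mu> where "\<mu> = (\<integral>x. g x * h x \<partial>lborel)"
  have gh: "integrable lborel (\<lambda>x. g x * h x)" by (rule integrable_mult_of_square[OF g h])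
  define Y where "Y i w = h (X i w) - \<mu>" for i w
  define v where "v = (\<integral>x. g x * (h x - \<mu>)\<^sup>2 \<partial>lborel)"
  have gY: "integrable lborel (\<lambda>x. g x * (h x - \<mu>)\<^sup>2)"
  proof -
    have "(\<lambda>x. g x * (h x - \<mu>)\<^sup>2) = (\<lambda>x. g x * (h x)\<^sup>2 - 2 * \<mu> * (g x * h x) + \<mu>\<^sup>2 * g x)"
      by (simp add: fun_eq_iff power2_eq_square algebra_simps)
    then show ?thesis using h(2) gh g(1) by simp
  qed
  have hX: "integrable M (\<lambda>w. h (X i w))" "expectation (\<lambda>w. h (X i w)) = \<mu>" for i
    using distributed_integrable[OF X, of h i] distributed_integral[OF X, of h i] g(2) gh
    by (simp_all add: \<mu>_def)
  have Y1: "integrable M (Y i)" "expectation (Y i) = 0" for i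
    unfolding Y_def using hX by (simp_all add: prob_space)
  have Y2: "integrable M (\<lambda>w. (Y i w)\<^sup>2)" "expectation (\<lambda>w. (Y i w)\<^sup>2) = v" for i
    using distributed_integrable[OF X, of "\<lambda>x. (h x - \<mu>)\<^sup>2" i]
      distributed_integral[OF X, of "\<lambda>x. (h x - \<mu>)\<^sup>2" i] g(2) gY
    by (simp_all add: Y_def v_def)
  have "indep_vars (\<lambda>_. borel) Y UNIV"
    unfolding Y_def by (rule indep_vars_compose2[OF indep]) measurable
  note sum2 = sum_square_expectation[OF this Y1(1) Y2(1) Y1(2) Y2(2)]
  have bound: "emeasure M {w \<in> space M. \<not> \<bar>empirical_mean n (\<lambda>i. X i w) h - \<mu>\<bar> \<le> \<epsilon>} \<le> ennreal (v / \<epsilon>\<^sup>2 * (1 / real n))" 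
    if n: "0 < n" for n
  proof -
    have centred: "empirical_mean n (\<lambda>i. X i w) h - \<mu> = (\<Sum>i<n. Y i w) / real n" for w
      using n by (simp add: empirical_mean_def Y_def sum_subtractf diff_divide_distrib)
    have "prob {w \<in> space M. \<not> \<bar>empirical_mean n (\<lambda>i. X i w) h - \<mu>\<bar> \<le> \<epsilon>} \<le> prob {w \<in> space M. (n * \<epsilon>)\<^sup>2 \<le> (\<Sum>i<n. Y i w)\<^sup>2}"
    proof (rule finite_measure_mono)
      show "{w \<in> space M. \<not> \<bar>empirical_mean n (\<lambda>i. X i w) h - \<mu>\<bar> \<le> \<epsilon>} \<subseteq> {w \<in> space M. (n * \<epsilon>)\<^sup>2 \<le> (\<Sum>i<n. Y i w)\<^sup>2}"
      proof safe
        fix w assume "\<not> \<bar>empirical_mean n (\<lambda>i. X i w) h - \<mu>\<bar> \<le> \<epsilon>"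
        then have "n * \<epsilon> \<le> \<bar>\<Sum>i<n. Y i w\<bar>" using n by (simp add: centred field_simps)
        then have "(n * \<epsilon>)\<^sup>2 \<le> \<bar>\<Sum>i<n. Y i w\<bar>\<^sup>2" using eps by (intro power_mono) auto
        then show "(n * \<epsilon>)\<^sup>2 \<le> (\<Sum>i<n. Y i w)\<^sup>2" by simp
      qed
      show "{w \<in> space M. (n * \<epsilon>)\<^sup>2 \<le> (\<Sum>i<n. Y i w)\<^sup>2} \<in> events" unfolding Y_def by measurable
    qed
    also have "\<dots> \<le> expectation (\<lambda>w. (\<Sum>i<n. Y i w)\<^sup>2) / (n * \<epsilon>)\<^sup>2"
      using sum2(1) n eps by (intro integral_Markov_inequality_measure[where A="{}"]) auto
    also have "\<dots> = v / \<epsilon>\<^sup>2 * (1 / real n)"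
      using n eps unfolding sum2(2) by (simp add: power2_eq_square)
    finally show ?thesis
      by (simp add: emeasure_eq_measure ennreal_leI)
  qed
  show ?thesis
    unfolding whp_def
  proof (rule tendsto_sandwich[OF _ _ tendsto_const])
    have "(\<lambda>n. ennreal (v / \<epsilon>\<^sup>2 * (1 / real n))) \<longlonglongrightarrow> ennreal (v / \<epsilon>\<^sup>2 * 0)"
      by (intro tendsto_ennrealI tendsto_mult tendsto_const lim_1_over_n)
    then show "(\<lambda>n. ennreal (v / \<epsilon>\<^sup>2 * (1 / real n))) \<longlonglongrightarrow> 0" by simp
    have "{w \<in> space M. \<not> \<bar>empirical_mean n (\<lambda>i. X i w) h - \<mu>\<bar> \<le> \<epsilon>} \<in> events" for n
      unfolding empirical_mean_def by measurable
    then show "\<forall>\<^sub>F n in sequentially. outer_measure_of M {w \<in> space M. \<not> \<bar>empirical_mean n (\<lambda>i. X i w) h - (\<integral>x. g x * h x \<partial>lborel)\<bar> \<le> \<epsilon>}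
        \<le> ennreal (v / \<epsilon>\<^sup>2 * (1 / real n))"
      using bound unfolding \<mu>_def[symmetric] by (intro eventually_sequentiallyI[of 1]) simp
  qed simp
qed

lemma distributed_AE_density_pos:
  assumes X: "distributed M lborel X (\<lambda>x. ennreal (g x))"
    and [measurable]: "g \<in> borel_measurable borel"
  shows "AE w in M. 0 < g (X w)"
proof -
  have X': "X \<in> measurable M lborel" by (rule distributed_measurable[OF X])
  have "AE x in density lborel (\<lambda>x. ennreal (g x)). 0 < g x"
    by (subst AE_density) (auto simp: ennreal_eq_0_iff not_less[symmetric])
  then have "AE x in distr M lborel X. 0 < g x"
    unfolding distributed_distr_eq_density[OF X] .
  then show ?thesis using X' by (simp add: AE_distr_iff)
qed

section \<open>Consistency\<close>

theorem theorem3p1: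
  fixes M :: "'w measure" and X :: "nat \<Rightarrow> 'w \<Rightarrow> real"
    and f0 g0 :: "real \<Rightarrow> real" and \<pi>0 u10 u20 :: real
    and pihat u1hat u2hat :: "nat \<Rightarrow> (nat \<Rightarrow> real) \<Rightarrow> real"
    and psihat :: "nat \<Rightarrow> (nat \<Rightarrow> real) \<Rightarrow> real \<Rightarrow> ereal"
    and fhat ghat :: "nat \<Rightarrow> (nat \<Rightarrow> real) \<Rightarrow> real \<Rightarrow> real"
  assumes "prob_space M"
    and "f0 \<in> SLC1" and "\<pi>0 \<in> {0<..<1} - {1/2}" and "u10 \<noteq> u20"
    and g0_def: "g0 = mix \<pi>0 u10 u20 f0"
    and iid: "prob_space.indep_vars M (\<lambda>_. borel) X UNIV"
      "\<And>i. distributed M lborel (X i) (\<lambda>x. ennreal (g0 x))"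
    and measurable_estimators:
      "\<And>n. pihat n \<in> borel_measurable (data_space n)"
      "\<And>n. u1hat n \<in> borel_measurable (data_space n)"
      "\<And>n. u2hat n \<in> borel_measurable (data_space n)"
    and range_estimators:
      "\<And>n x. x \<in> space (data_space n) \<Longrightarrow> pihat n x \<in> {0<..<1} - {1/2}"
      "\<And>n x. x \<in> space (data_space n) \<Longrightarrow> u1hat n x < u2hat n x"
    and consistent:
      "tendsto_in_prob M (\<lambda>n w. pihat n (sample X n w)) \<pi>0"
      "tendsto_in_prob M (\<lambda>n w. u1hat n (sample X n w)) u10"
      "tendsto_in_prob M (\<lambda>n w. u2hat n (sample X n w)) u20"
    and MLE: "\<forall>\<^sub>F n in sequentially. AE w in M. let x = sample X n w in
      is_MLE n x (pihat n x) (u1hat n x) (u2hat n x) (psihat n x)"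
    and fhat_def: "\<And>n x z. fhat n x z = exp_ereal (psihat n x z)"
    and ghat_def: "\<And>n x. ghat n x = mix (pihat n x) (u1hat n x) (u2hat n x) (fhat n x)"
  shows "tendsto_in_prob M (\<lambda>n w. hellinger (ghat n (sample X n w)) g0) 0"
proof -
  interpret prob_space M by fact
  have f0: "f0 \<in> SLC1" and pi0: "0 < \<pi>0" "\<pi>0 < 1" using assms(2,3) by auto
  have f0': "f0 \<in> SLC" using f0 by (simp add: SLC1_def)
  have g0_nonneg: "0 \<le> g0 x" for x
    unfolding g0_def using pi0 by (intro mix_nonneg[OF f0']) auto
  have g0_int: "integrable lborel g0" unfolding g0_def by (rule mix_integral(1)[OF f0])
  have empirical_mean_sample: "empirical_mean n (sample X n w) h = empirical_mean n (\<lambda>i. X i w) h" for n w h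
    by (simp add: empirical_mean_def sample_def)
  have "g0 \<in> borel_measurable borel"
    using borel_measurable_integrable[OF g0_int] by simp
  then have "AE w in M. 0 < g0 (X i w)" for i
    by (rule distributed_AE_density_pos[OF iid(2)])
  then have pos: "AE w in M. \<forall>i. 0 < g0 (X i w)" by (simp add: AE_all_countable)
  show ?thesis
    unfolding tendsto_in_prob_iff_whp
  proof (intro allI impI)
    fix \<epsilon> :: real assume eps: "0 < \<epsilon>"
    obtain \<kappa> and H :: "(real \<Rightarrow> real) set" where \<kappa>: "0 < \<kappa>" and H: "finite H"
      "\<And>h. h \<in> H \<Longrightarrow> h \<in> borel_measurable borel \<and> integrable lborel (\<lambda>x. g0 x * (h x)\<^sup>2)"
      and main: "\<And>n x \<pi> u1 u2 \<psi>. 0 < n \<Longrightarrow> is_MLE n x \<pi> u1 u2 \<psi> \<Longrightarrow> (\<And>i. i < n \<Longrightarrow> 0 < g0 (x i)) \<Longrightarrow>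
        \<bar>\<pi> - \<pi>0\<bar> \<le> \<kappa> \<Longrightarrow> \<bar>u1 - u10\<bar> \<le> \<kappa> \<Longrightarrow> \<bar>u2 - u20\<bar> \<le> \<kappa> \<Longrightarrow>
        (\<And>h. h \<in> H \<Longrightarrow> \<bar>empirical_mean n x h - (\<integral>z. g0 z * h z \<partial>lborel)\<bar> \<le> \<kappa>) \<Longrightarrow>
        hellinger (mix \<pi> u1 u2 (\<lambda>z. exp_ereal (\<psi> z))) g0 \<le> \<epsilon>"
      by (rule hellinger_MLE_le[OF f0 pi0 eps g0_def]) (use that in blast)
    have lln: "whp M (\<lambda>n w. \<forall>h\<in>H. \<bar>empirical_mean n (sample X n w) h - (\<integral>z. g0 z * h z \<partial>lborel)\<bar> \<le> \<kappa>)"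
      unfolding empirical_mean_sample
      using H(2) by (intro whp_finite_ball[OF H(1)] weak_law_of_large_numbers[OF iid g0_int g0_nonneg _ _ \<kappa>]) auto
    have est: "whp M (\<lambda>n w. \<bar>pihat n (sample X n w) - \<pi>0\<bar> \<le> \<kappa>)"
      "whp M (\<lambda>n w. \<bar>u1hat n (sample X n w) - u10\<bar> \<le> \<kappa>)"
      "whp M (\<lambda>n w. \<bar>u2hat n (sample X n w) - u20\<bar> \<le> \<kappa>)"
      using consistent \<kappa> unfolding tendsto_in_prob_iff_whp by auto
    have mle: "whp M (\<lambda>n w. is_MLE n (sample X n w) (pihat n (sample X n w)) (u1hat n (sample X n w))
        (u2hat n (sample X n w)) (psihat n (sample X n w)) \<and> (\<forall>i. 0 < g0 (X i w)))"
    proof (rule whp_AE)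
      show "\<forall>\<^sub>F n in sequentially. AE w in M. is_MLE n (sample X n w) (pihat n (sample X n w))
        (u1hat n (sample X n w)) (u2hat n (sample X n w)) (psihat n (sample X n w)) \<and> (\<forall>i. 0 < g0 (X i w))"
        using MLE by eventually_elim (use pos in \<open>auto simp: Let_def\<close>)
    qed
    show "whp M (\<lambda>n w. \<bar>hellinger (ghat n (sample X n w)) g0 - 0\<bar> \<le> \<epsilon>)"
    proof (rule whp_mono[OF whp_conj[OF mle whp_conj[OF lln whp_conj[OF est(1) whp_conj[OF est(2,3)]]]]],
        rule eventually_sequentiallyI[of 1], intro ballI impI, elim conjE)
      fix n w
      let ?x = "sample X n w"
      assume n: "1 \<le> n" and mle: "is_MLE n ?x (pihat n ?x) (u1hat n ?x) (u2hat n ?x) (psihat n ?x)"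
        and pos: "\<forall>i. 0 < g0 (X i w)"
        and freq: "\<forall>h\<in>H. \<bar>empirical_mean n ?x h - (\<integral>z. g0 z * h z \<partial>lborel)\<bar> \<le> \<kappa>"
        and est: "\<bar>pihat n ?x - \<pi>0\<bar> \<le> \<kappa>" "\<bar>u1hat n ?x - u10\<bar> \<le> \<kappa>" "\<bar>u2hat n ?x - u20\<bar> \<le> \<kappa>"
      have "0 < g0 (?x i)" if "i < n" for i using pos that by (simp add: sample_def)
      then have "hellinger (mix (pihat n ?x) (u1hat n ?x) (u2hat n ?x) (\<lambda>z. exp_ereal (psihat n ?x z))) g0 \<le> \<epsilon>"
        using n mle est freq by (intro main) auto
      moreover have "fhat n ?x = (\<lambda>z. exp_ereal (psihat n ?x z))" by (simp add: fun_eq_iff fhat_def)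
      moreover have "0 \<le> hellinger p q" for p q by (simp add: hellinger_def)
      ultimately show "\<bar>hellinger (ghat n ?x) g0 - 0\<bar> \<le> \<epsilon>" by (simp add: ghat_def)
    qed
  qed
qed

end
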